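(* Let $N\ge 1$ and $j,k,n\ge 1$ be integers. Then $$\int_{U(N)} H_j^{(n)}(g)\, \overline{H_k^{(n)}(g)}\,dg = \sum_{d=1}^{\min(n,N)} \big(d^j - (d-1)^j\big)\big(d^k - (d-1)^k\big).$$ Additionally, if $m\ge 1$ is an integer with $m\neq n$, then $$\int_{U(N)} H_j^{(n)}(g)\, \overline{H_k^{(m)}(g)}\, dg = 0.$$
   Context: $U(N)$ is the group of $N\times N$ unitary matrices and $dg$ is Haar probability measure on it. For a square matrix $g$ and integers $n\ge1$, $j\ge 1$, the quantities $H_j^{(n)}=H_j^{(n)}(g)$ are defined inductively in $j$ by $$H_1^{(n)}(g)=-\mathrm{Tr}(g^n),$$ and, for $j\ge 2$, $$H_j^{(n)}=\sum_{\substack{\ell+\lambda=n\\ \ell,\lambda\ge 1}}H_1^{(\lambda)}H_{j-1}^{(\ell)}+n\,H_{j-1}^{(n)},$$ where the sum is over pairs of positive integers $(\ell,\lambda)$ with $\ell+\lambda=n$ (empty if $n=1$). *)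

theory Defs
  imports "HOL-Analysis.Analysis" "HOL-Probability.Probability_Measure"
begin

definition conj_transpose :: "complex^'n^'m \<Rightarrow> complex^'m^'n" where
  "conj_transpose A = (\<chi> i j. cnj (A $ j $ i))"

definition unitary_group :: "(complex^'n^'n) set" where
  "unitary_group = {g. conj_transpose g ** g = mat 1 \<and> g ** conj_transpose g = mat 1}"

(* The product * and power ^ on the type complex^'n^'n are not the matrix ones
   (the library product is componentwise), so powers are built from **. *)
primrec matrix_power :: "complex^'n^'n \<Rightarrow> nat \<Rightarrow> complex^'n^'n" where
  "matrix_power g 0 = mat 1"
| "matrix_power g (Suc n) = g ** matrix_power g n"

(* Haar probability measure on U(N), N = CARD('n): a Borel probability measure with
   underlying space U(N) that is invariant under left translation.  By uniqueness of
   Haar measure at most one M satisfies this; U(N) being compact, it is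
   automatically regular and right-invariant. *)
definition haar_prob_measure :: "(complex^'n^'n) measure \<Rightarrow> bool" where
  "haar_prob_measure M \<longleftrightarrow>
     prob_space M \<and>
     space M = unitary_group \<and>
     sets M = sets (restrict_space borel unitary_group) \<and>
     (\<forall>h\<in>unitary_group. distr M M (\<lambda>g. h ** g) = M)"

(* H j n g is H_j^{(n)}(g) for j, n >= 1; the value at j = 0 is a dummy.
   The sum over l + m = n with l, m >= 1 is indexed by l, with m = n - l >= 1. *)
fun H :: "nat \<Rightarrow> nat \<Rightarrow> complex^'n^'n \<Rightarrow> complex" where
  "H 0 n g = 0"
| "H (Suc 0) n g = - trace (matrix_power g n)"
| "H (Suc (Suc j)) n g =
     (\<Sum>l\<in>{1..<n}. H (Suc 0) (n - l) g * H (Suc j) l g) + of_nat n * H (Suc j) n g"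

end

theory Submission
  imports Defs
begin

text \<open>
  Write \<open>p\<^sub>k = Tr (g\<^sup>k)\<close> and let \<open>h\<^sub>a\<close> and \<open>e\<^sub>c\<close> be the complete and the elementary symmetric
  polynomials of the eigenvalues of \<open>g\<close>.  The series \<open>E(x) = det (1 - x g) = \<Sum> (-1)\<^sup>c e\<^sub>c x\<^sup>c\<close>
  satisfies \<open>D E = - (\<Sum> p\<^sub>k x\<^sup>k) E\<close> for \<open>D = x d/dx\<close>, so in terms of the series \<open>F\<^sub>j = \<Sum> H\<^sub>j\<^sup>(\<^sup>n\<^sup>) x\<^sup>n\<close>
  the recursion in \<open>j\<close> says \<open>F\<^sub>j = E\<inverse> D (E F\<^sub>j\<^sub>-\<^sub>1)\<close>, whence \<open>F\<^sub>j = E\<inverse> D\<^sup>j E\<close> and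
  \<open>H\<^sub>j\<^sup>(\<^sup>n\<^sup>) = \<Sum>\<^sub>c c\<^sup>j (-1)\<^sup>c h\<^sub>n\<^sub>-\<^sub>c e\<^sub>c\<close>.  The product \<open>h\<^sub>n\<^sub>-\<^sub>c e\<^sub>c\<close> is the sum of the Schur functions of
  two neighbouring hooks of size \<open>n\<close>, so summation by parts turns this into a combination of the hooks
  \<open>(n - d + 1, 1\<^sup>d\<^sup>-\<^sup>1)\<close>, \<open>1 \<le> d \<le> n\<close>, with coefficients \<open>\<plusminus>(d\<^sup>j - (d - 1)\<^sup>j)\<close>
  (lemma \<open>H_eq_hooks\<close>).  The claim thus becomes: hook Schur functions with at most \<open>N\<close> rows are
  orthonormal, and those with more rows vanish (theorem \<open>hook_orthonormal\<close>).

  This orthonormality is derived from left invariance of the measure.  Differentiating the invariance along one-parameter subgroups gives an integration by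
  parts formula (\<open>integration_by_parts\<close>) and from it a Green identity
  \<open>\<integral> (\<Delta>f) cnj \<phi> = \<integral> \<langle>\<nabla>f, \<nabla>\<phi>\<rangle>\<close> (\<open>green_identity\<close>), where \<open>\<Delta>\<close> is the Casimir operator of \<open>U(N)\<close>.
  Three consequences suffice.

  \<^item> The hook with \<open>b + 1\<close> rows is an eigenfunction of \<open>\<Delta>\<close> with eigenvalue \<open>n (N + n - 1 - 2 b)\<close>
    (\<open>has_laplacian_hook\<close>).  For fixed \<open>n\<close> these numbers are distinct, so the hooks of size \<open>n\<close> are
    orthogonal.  Functions of different degree are orthogonal because the trace of the gradient is
    the degree operator.
  \<^item> The eigenvalue of \<open>e\<^sub>c\<close> is \<open>c (N + 1 - c)\<close>.  For \<open>c > N\<close> it is not positive, while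
    \<open>\<integral> |\<nabla>e\<^sub>c|\<^sup>2\<close> is not negative; so the gradient vanishes almost everywhere, and with it \<open>e\<^sub>c\<close>.
  \<^item> The power sum \<open>p\<^sub>n\<close> is the alternating sum of the hooks of size \<open>n\<close>, and \<open>\<nabla>p\<^sub>n = n g\<^sup>n\<close>.
    The Green identity for a hook and \<open>p\<^sub>n\<close> expresses the norm of the hook by norms of smaller
    hooks (\<open>hook_norm_recursion\<close>), and induction on \<open>n\<close> shows that all norms are \<open>1\<close>.

  The symmetric polynomials are defined from the \<open>p\<^sub>k\<close> by Newton's identities, and their algebraic
  properties are all derived from these.
\<close>

section \<open>One-parameter subgroups of the unitary group\<close>

text \<open>
  The matrix \<open>1 + z X\<close>.  For an orthogonal projection \<open>X = Q\<close> and \<open>z = e\<^sup>i\<^sup>t - 1\<close> it is the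
  unitary matrix \<open>exp (i t Q)\<close>, so one formula covers both complex differentiation in \<open>z\<close> and
  one-parameter subgroups in \<open>t\<close>.
\<close>

definition perturb :: "complex^'n^'n \<Rightarrow> complex \<Rightarrow> complex^'n^'n" where
  "perturb X z = (\<chi> i j. (if i = j then 1 else 0) + z * X $ i $ j)"

lemma perturb_mult_entry: "(perturb X z ** g) $ i $ j = g $ i $ j + z * (X ** g) $ i $ j"
proof -
  have "(perturb X z ** g) $ i $ j = (\<Sum>k\<in>UNIV. (if i = k then g $ k $ j else 0) + z * (X $ i $ k * g $ k $ j))"
    unfolding perturb_def matrix_matrix_mult_def
    by (auto intro!: sum.cong simp: algebra_simps)
  thus ?thesis
    by (simp add: sum.distrib matrix_matrix_mult_def sum_distrib_left)
qed

lemma perturb_0 [simp]: "perturb X 0 = mat 1"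
  by (simp add: perturb_def mat_def)

lemma perturb_perturb:
  assumes "Q ** Q = Q"
  shows "perturb Q y ** perturb Q z = perturb Q (y + z + y * z)"
proof -
  have e: "(perturb Q y ** perturb Q z) $ i $ j = perturb Q (y + z + y * z) $ i $ j" for i j
  proof -
    have "(Q ** perturb Q z) $ i $ j = Q $ i $ j + z * (Q ** Q) $ i $ j"
    proof -
      have "(Q ** perturb Q z) $ i $ j = (\<Sum>k\<in>UNIV. (if k = j then Q $ i $ k else 0) + z * (Q $ i $ k * Q $ k $ j))"
        unfolding perturb_def matrix_matrix_mult_def
        by (auto intro!: sum.cong simp: algebra_simps)
      thus ?thesis
        by (simp add: sum.distrib matrix_matrix_mult_def sum_distrib_left)
    qed
    thus ?thesis unfolding perturb_mult_entry assms
      by (simp add: perturb_def algebra_simps)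
  qed
  show ?thesis by (simp add: vec_eq_iff e)
qed

lemma conj_transpose_perturb:
  assumes "conj_transpose Q = Q"
  shows "conj_transpose (perturb Q z) = perturb Q (cnj z)"
proof -
  have "cnj (Q $ j $ i) = Q $ i $ j" for i j
    by (subst (2) assms[symmetric]) (simp add: conj_transpose_def)
  thus ?thesis by (auto simp: conj_transpose_def perturb_def vec_eq_iff)
qed

lemma perturb_cis_unitary:
  assumes "Q ** Q = Q" "conj_transpose Q = Q"
  shows "perturb Q (cis t - 1) \<in> unitary_group"
proof -
  have "cis t * cnj (cis t) = 1"
    by (simp add: cis_cnj cis_mult)
  hence "(cnj (cis t - 1)) + (cis t - 1) + (cnj (cis t - 1)) * (cis t - 1) = 0"
        "(cis t - 1) + (cnj (cis t - 1)) + (cis t - 1) * (cnj (cis t - 1)) = 0"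
    by (simp_all add: algebra_simps)
  thus ?thesis unfolding unitary_group_def
    by (simp only: mem_Collect_eq conj_transpose_perturb[OF assms(2)] perturb_perturb[OF assms(1)] perturb_0)
qed

lemma conj_transpose_mult: "conj_transpose (A ** B) = conj_transpose B ** conj_transpose A"
  by (simp add: conj_transpose_def matrix_matrix_mult_def vec_eq_iff mult.commute)

lemma unitary_mult:
  assumes "g \<in> unitary_group" "h \<in> unitary_group"
  shows "g ** h \<in> unitary_group"
proof -
  have "conj_transpose h ** conj_transpose g ** (g ** h) = conj_transpose h ** (conj_transpose g ** g) ** h"
    "g ** h ** (conj_transpose h ** conj_transpose g) = g ** (h ** conj_transpose h) ** conj_transpose g"
    by (simp_all only: matrix_mul_assoc)
  with assms show ?thesis
    unfolding unitary_group_def by (simp add: conj_transpose_mult)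
qed

lemma continuous_on_matrix_mult [continuous_intros]:
  fixes A B :: "'a::topological_space \<Rightarrow> complex^'n^'n"
  assumes "continuous_on S A" "continuous_on S B"
  shows "continuous_on S (\<lambda>x. A x ** B x)"
  unfolding matrix_matrix_mult_def by (intro continuous_intros assms)

lemma continuous_on_conj_transpose [continuous_intros]:
  fixes A :: "'a::topological_space \<Rightarrow> complex^'n^'n"
  assumes "continuous_on S A"
  shows "continuous_on S (\<lambda>x. conj_transpose (A x))"
  unfolding conj_transpose_def by (intro continuous_intros assms)

text \<open>
  The rows of a unitary matrix have norm 1, which bounds the group.  Compactness makes every continuous
  function bounded on it, hence integrable.
\<close>

lemma compact_unitary_group: "compact (unitary_group :: (complex^'n^'n) set)"
proof -
  have "closed {g :: complex^'n^'n. conj_transpose g ** g = mat 1}"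
       "closed {g :: complex^'n^'n. g ** conj_transpose g = mat 1}"
    by (intro closed_Collect_eq continuous_intros)+
  hence cl: "closed (unitary_group :: (complex^'n^'n) set)"
    unfolding unitary_group_def by (intro closed_Collect_conj)
  have "norm (g $ i $ j) \<le> 1" if "g \<in> unitary_group" for g :: "complex^'n^'n" and i j
  proof -
    have "(g ** conj_transpose g) $ i $ i = 1"
      using that by (simp add: unitary_group_def mat_def)
    hence "(\<Sum>k\<in>UNIV. complex_of_real ((norm (g $ i $ k))^2)) = 1"
      by (simp only: matrix_matrix_mult_def conj_transpose_def vec_lambda_beta complex_norm_square)
    hence "(\<Sum>k\<in>UNIV. (norm (g $ i $ k))^2) = 1"
      by (simp only: of_real_eq_1_iff flip: of_real_sum)
    moreover have "(norm (g $ i $ j))^2 \<le> (\<Sum>k\<in>UNIV. (norm (g $ i $ k))^2)"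
      by (intro member_le_sum) auto
    ultimately have "(norm (g $ i $ j))^2 \<le> 1" by simp
    thus ?thesis by (simp add: power_le_one_iff abs_square_le_1)
  qed
  hence "norm g \<le> (\<Sum>i\<in>(UNIV::'n set). \<Sum>j\<in>(UNIV::'n set). 1)"
    if "g \<in> unitary_group" for g :: "complex^'n^'n"
    using that unfolding norm_vec_def
    by (intro order.trans[OF L2_set_le_sum] sum_mono order.trans[OF L2_set_le_sum]) auto
  hence "bounded (unitary_group :: (complex^'n^'n) set)"
    unfolding bounded_iff by blast
  with cl show ?thesis by (simp add: compact_eq_bounded_closed)
qed

section \<open>Integrals of derivatives along a flow\<close>

lemma haar_integrable:
  fixes f :: "complex^'n^'n \<Rightarrow> complex"
  assumes "haar_prob_measure M" "continuous_on unitary_group f"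
  shows "integrable M f"
proof -
  interpret prob_space M using assms by (simp add: haar_prob_measure_def)
  have "compact (f ` unitary_group)"
    using assms(2) compact_unitary_group by (rule compact_continuous_image)
  then obtain B where B: "\<And>g. g \<in> unitary_group \<Longrightarrow> norm (f g) \<le> B"
    by (meson bounded_iff compact_imp_bounded imageI)
  have "f \<in> borel_measurable (restrict_space borel unitary_group)"
    by (rule borel_measurable_continuous_on_restrict) fact
  hence "f \<in> borel_measurable M"
    using assms(1) by (subst measurable_cong_sets) (auto simp: haar_prob_measure_def)
  thus ?thesis
    using assms(1) by (intro integrable_const_bound[of _ B] AE_I2) (auto simp: haar_prob_measure_def B)
qed

lemma haar_translate:
  fixes f :: "complex^'n^'n \<Rightarrow> complex"
  assumes M: "haar_prob_measure M" and f: "continuous_on unitary_group f" and h: "h \<in> unitary_group"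
  shows "(LINT g|M. f (h ** g)) = (LINT g|M. f g)"
proof -
  have sets: "sets M = sets (restrict_space borel unitary_group)"
    and inv: "distr M M (\<lambda>g. h ** g) = M"
    using M h by (auto simp: haar_prob_measure_def)
  have "(\<lambda>g. h ** g) \<in> borel_measurable (restrict_space borel unitary_group)"
    by (rule borel_measurable_continuous_on_restrict) (intro continuous_intros)
  hence "(\<lambda>g. h ** g) \<in> measurable (restrict_space borel unitary_group) (restrict_space borel unitary_group)"
    by (rule measurable_restrict_space2[rotated]) (auto simp: space_restrict_space unitary_mult h)
  hence meas: "(\<lambda>g. h ** g) \<in> measurable M M"
    using measurable_cong_sets[OF sets sets] by blast
  have "f \<in> borel_measurable M"
    using haar_integrable[OF M f] by (rule borel_measurable_integrable)
  from integral_distr[OF meas this] show ?thesis by (simp add: inv)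
qed

text \<open>
  By invariance, the integral of each difference quotient \<open>(u(h\<^sub>t g) - u(g)) / t\<close> is 0.  The flow
  property makes \<open>u'\<close> the derivative at every time, so its bound on the compact group is a Lipschitz
  constant and dominates the quotients as \<open>t\<close> tends to 0.
\<close>

lemma integral_derivative_along_flow_eq_0:
  fixes u u' :: "complex^'n^'n \<Rightarrow> complex" and h :: "real \<Rightarrow> complex^'n^'n"
  assumes M: "haar_prob_measure M"
    and u: "continuous_on unitary_group u" and u': "continuous_on unitary_group u'"
    and h: "\<And>t. h t \<in> unitary_group" and h0: "h 0 = mat 1" and h_add: "\<And>s t. h (s + t) = h s ** h t"
    and der: "\<And>g. ((\<lambda>t. u (h t ** g)) has_vector_derivative u' g) (at 0)"
  shows "(LINT g|M. u' g) = 0"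
proof -
  have sp: "space M = unitary_group" using M by (auto simp: haar_prob_measure_def)
  interpret prob_space M using M by (simp add: haar_prob_measure_def)
  \<comment> \<open>restart the flow at time \<open>t\<close> from the point \<open>h t ** g\<close>\<close>
  have der': "((\<lambda>s. u (h s ** g)) has_vector_derivative u' (h t ** g)) (at t)" for t g
  proof -
    have "((\<lambda>s. u (h s ** (h t ** g))) \<circ> (\<lambda>s. s - t) has_vector_derivative (1 *\<^sub>R u' (h t ** g))) (at t)"
      by (rule vector_diff_chain_at) (auto intro!: derivative_eq_intros der)
    moreover have "((\<lambda>s. u (h s ** (h t ** g))) \<circ> (\<lambda>s. s - t)) = (\<lambda>s. u (h s ** g))"
      by (simp add: fun_eq_iff matrix_mul_assoc flip: h_add)
    ultimately show ?thesis by simp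
  qed
  have "compact (u' ` unitary_group)"
    using u' compact_unitary_group by (rule compact_continuous_image)
  then obtain B where B: "\<And>g. g \<in> unitary_group \<Longrightarrow> norm (u' g) \<le> B"
    by (meson bounded_iff compact_imp_bounded imageI)
  have lip: "norm (u (h t ** g) - u g) \<le> B * \<bar>t\<bar>" if "g \<in> unitary_group" for t g
  proof -
    have "norm (u (h t ** g) - u (h 0 ** g)) \<le> B * norm (t - 0)"
    proof (rule differentiable_bound[where S = UNIV])
      show "((\<lambda>s. u (h s ** g)) has_derivative (\<lambda>x. x *\<^sub>R u' (h s ** g))) (at s within UNIV)" for s
        using der' unfolding has_vector_derivative_def by simp
      have "norm (u' (h s ** g)) \<le> B" for s
        by (intro B unitary_mult h that)
      thus "onorm (\<lambda>x. x *\<^sub>R u' (h s ** g)) \<le> B" for s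
        by (simp only: onorm_scaleR_left[OF bounded_linear_ident] onorm_id mult_1_left)
    qed auto
    thus ?thesis by (simp add: h0)
  qed
  define q where "q n g = (u (h (inverse (real (Suc n))) ** g) - u g) /\<^sub>R inverse (real (Suc n))" for n g
  have cont_q: "continuous_on unitary_group (\<lambda>g. u (h t ** g))" for t
    by (rule continuous_on_compose2[OF u]) (auto intro!: continuous_intros unitary_mult h)
  have "(\<lambda>n. LINT g|M. q n g) \<longlonglongrightarrow> (LINT g|M. u' g)"
  proof (rule integral_dominated_convergence[where w = "\<lambda>_. B"])
    show "u' \<in> borel_measurable M"
      using haar_integrable[OF M u'] by (rule borel_measurable_integrable)
    show "q n \<in> borel_measurable M" for n
    proof -
      have "continuous_on unitary_group (\<lambda>g. q n g)"
        unfolding q_def by (intro continuous_intros cont_q u)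
      from haar_integrable[OF M this] show ?thesis by (rule borel_measurable_integrable)
    qed
    show "AE g in M. (\<lambda>n. q n g) \<longlonglongrightarrow> u' g"
    proof (rule AE_I2)
      fix g
      have lim: "((\<lambda>t. norm (u (h t ** g) - u g - t *\<^sub>R u' g) / norm t) \<longlongrightarrow> 0) (at 0)"
        using der[of g] by (simp add: has_vector_derivative_def has_derivative_at h0)
      have eq: "norm (u (h t ** g) - u g - t *\<^sub>R u' g) / norm t = norm ((u (h t ** g) - u g) /\<^sub>R t - u' g)"
        if "t \<noteq> 0" for t
      proof -
        have "(u (h t ** g) - u g) /\<^sub>R t - u' g = (u (h t ** g) - u g - t *\<^sub>R u' g) /\<^sub>R t"
          by (simp only: scaleR_diff_right scaleR_scaleR left_inverse[OF that] scaleR_one)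
        hence "norm ((u (h t ** g) - u g) /\<^sub>R t - u' g) = inverse (norm t) * norm (u (h t ** g) - u g - t *\<^sub>R u' g)"
          by (simp only: norm_scaleR norm_inverse real_norm_def abs_inverse)
        thus ?thesis by (metis divide_inverse mult.commute)
      qed
      have "((\<lambda>t. norm (u (h t ** g) - u g - t *\<^sub>R u' g) / norm t) \<longlongrightarrow> 0) (at 0) \<longleftrightarrow>
            ((\<lambda>t. norm ((u (h t ** g) - u g) /\<^sub>R t - u' g)) \<longlongrightarrow> 0) (at 0)"
        by (rule LIM_equal) (rule allI, rule impI, rule eq)
      with lim have "((\<lambda>t. norm ((u (h t ** g) - u g) /\<^sub>R t - u' g)) \<longlongrightarrow> 0) (at 0)"
        by (rule iffD1[rotated])
      hence "((\<lambda>t. (u (h t ** g) - u g) /\<^sub>R t) \<longlongrightarrow> u' g) (at 0)"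
        by (rule LIM_zero_cancel[OF tendsto_norm_zero_cancel])
      thus "(\<lambda>n. q n g) \<longlonglongrightarrow> u' g"
        unfolding q_def
        using LIMSEQ_inverse_real_of_nat
        by (rule filterlim_compose[OF _ filterlim_atI]) auto
    qed
    show "AE g in M. norm (q n g) \<le> B" for n
    proof (rule AE_I2)
      fix g assume "g \<in> space M"
      hence "norm (u (h (inverse (real (Suc n))) ** g) - u g) \<le> B * inverse (real (Suc n))"
        using lip[of g "inverse (real (Suc n))"] by (simp add: sp)
      hence "real (Suc n) * norm (u (h (inverse (real (Suc n))) ** g) - u g) \<le> real (Suc n) * (B * inverse (real (Suc n)))"
        by (rule mult_left_mono) simp
      thus "norm (q n g) \<le> B"
        unfolding q_def by (simp add: norm_scaleR mult.left_commute del: of_nat_Suc)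
    qed
  qed auto
  moreover have "(LINT g|M. q n g) = 0" for n
    unfolding q_def
    by (simp add: integral_diff haar_integrable[OF M cont_q] haar_integrable[OF M u] haar_translate[OF M u h])
  ultimately show ?thesis
    by (simp add: LIMSEQ_const_iff)
qed

section \<open>Gradients and integration by parts\<close>

text \<open>
  The gradient is taken with respect to left multiplication: the derivative of \<open>f\<close> at \<open>g\<close> in the
  direction \<open>X g\<close> is \<open>Tr (X (W g))\<close>.  Admitting all complex matrices \<open>X\<close>, not only skew-Hermitian ones, expresses
  that \<open>f\<close> is holomorphic in these directions.  Continuity is included so that all integrals over the
  group exist.
\<close>

definition has_gradient :: "(complex^'n^'n \<Rightarrow> complex) \<Rightarrow> (complex^'n^'n \<Rightarrow> complex^'n^'n) \<Rightarrow> bool" where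
  "has_gradient f W \<longleftrightarrow> continuous_on UNIV f \<and> continuous_on UNIV W \<and>
     (\<forall>X g. ((\<lambda>z. f (perturb X z ** g)) has_field_derivative (\<Sum>a\<in>UNIV. \<Sum>b\<in>UNIV. X $ a $ b * W g $ b $ a)) (at 0))"

lemma has_gradient_continuous:
  assumes "has_gradient f W"
  shows "continuous_on S f" "continuous_on S W"
  using assms unfolding has_gradient_def by (auto intro: continuous_on_subset)

text \<open>
  Along the flow \<open>exp (i t Q)\<close> the derivative of \<open>w cnj \<phi>\<close> is
  \<open>i (Tr (Q W) cnj \<phi> - w cnj (Tr (Q \<Phi>)))\<close>; the sign comes from the conjugation of \<open>i\<close>.
\<close>

lemma integration_by_parts_projection:
  fixes w \<phi> :: "complex^'n^'n \<Rightarrow> complex"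
  assumes M: "haar_prob_measure M" and w: "has_gradient w W" and \<phi>: "has_gradient \<phi> \<Phi>"
    and Q: "Q ** Q = Q" "conj_transpose Q = Q"
  shows "(LINT g|M. (\<Sum>a\<in>UNIV. \<Sum>b\<in>UNIV. Q $ a $ b * W g $ b $ a) * cnj (\<phi> g)) =
         (LINT g|M. w g * cnj (\<Sum>a\<in>UNIV. \<Sum>b\<in>UNIV. Q $ a $ b * \<Phi> g $ b $ a))"
proof -
  let ?w = "\<lambda>g. \<Sum>a\<in>UNIV. \<Sum>b\<in>UNIV. Q $ a $ b * W g $ b $ a"
  let ?\<phi> = "\<lambda>g. \<Sum>a\<in>UNIV. \<Sum>b\<in>UNIV. Q $ a $ b * \<Phi> g $ b $ a"
  define u' where "u' g = \<i> * (?w g * cnj (\<phi> g) - w g * cnj (?\<phi> g))" for g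
  note cont = has_gradient_continuous[OF w] has_gradient_continuous[OF \<phi>]
  have "(LINT g|M. u' g) = 0"
  proof (rule integral_derivative_along_flow_eq_0[OF M])
    show "continuous_on unitary_group (\<lambda>g. w g * cnj (\<phi> g))" "continuous_on unitary_group u'"
      unfolding u'_def by (intro continuous_intros cont)+
    show "perturb Q (cis t - 1) \<in> unitary_group" for t
      by (rule perturb_cis_unitary[OF Q])
    show "perturb Q (cis 0 - 1) = mat 1" by simp
    show "perturb Q (cis (s + t) - 1) = perturb Q (cis s - 1) ** perturb Q (cis t - 1)" for s t
      unfolding perturb_perturb[OF Q(1)] by (simp add: cis_mult[symmetric] algebra_simps)
    fix g
    have cis: "((\<lambda>t. cis t - 1) has_vector_derivative \<i>) (at 0)"
      unfolding has_vector_derivative_def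
      by (rule derivative_eq_intros refl | simp add: fun_eq_iff scaleR_conv_of_real)+
    have along: "((\<lambda>t. f (perturb Q (cis t - 1) ** g)) has_vector_derivative
                 (\<i> * (\<Sum>a\<in>UNIV. \<Sum>b\<in>UNIV. Q $ a $ b * F g $ b $ a))) (at 0)"
      if "has_gradient f F" for f F
      using field_vector_diff_chain_at[OF cis, of "\<lambda>z. f (perturb Q z ** g)"] that
      unfolding has_gradient_def by (simp add: o_def)
    have "((\<lambda>t. w (perturb Q (cis t - 1) ** g) * cnj (\<phi> (perturb Q (cis t - 1) ** g)))
        has_vector_derivative (w (perturb Q (cis 0 - 1) ** g) * cnj (\<i> * ?\<phi> g) + \<i> * ?w g * cnj (\<phi> (perturb Q (cis 0 - 1) ** g)))) (at 0)"
      by (intro has_vector_derivative_mult has_vector_derivative_cnj along w \<phi>)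
    moreover have "(w (perturb Q (cis 0 - 1) ** g) * cnj (\<i> * ?\<phi> g) + \<i> * ?w g * cnj (\<phi> (perturb Q (cis 0 - 1) ** g))) = u' g"
      by (simp add: u'_def algebra_simps del: cnj_sum)
    ultimately show "((\<lambda>t. w (perturb Q (cis t - 1) ** g) * cnj (\<phi> (perturb Q (cis t - 1) ** g)))
        has_vector_derivative u' g) (at 0)" by simp
  qed
  moreover have "(LINT g|M. u' g) = \<i> * ((LINT g|M. ?w g * cnj (\<phi> g)) - (LINT g|M. w g * cnj (?\<phi> g)))"
    unfolding u'_def
    by (simp only: integral_mult_right_zero, subst Bochner_Integration.integral_diff)
       (intro haar_integrable[OF M] continuous_intros cont refl)+
  ultimately show ?thesis by simp
qed

text \<open>
  Polarisation with the vectors \<open>e\<^sub>j + z e\<^sub>k\<close>, for which \<open>z = 0, 1, i\<close> are enough.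
\<close>

lemma sesquilinear_form_zero_imp_zero:
  fixes D :: "complex^'n^'n"
  assumes "\<And>v :: complex^'n. (\<Sum>a\<in>UNIV. \<Sum>b\<in>UNIV. v $ a * cnj (v $ b) * D $ a $ b) = 0"
  shows "D = 0"
proof -
  have eq: "D $ j $ j + cnj z * D $ j $ k + z * D $ k $ j + z * cnj z * D $ k $ k = 0" for j k z
  proof -
    let ?v = "(\<chi> a. (if a = j then 1 else 0) + (if a = k then z else 0)) :: complex^'n"
    have pick: "(\<Sum>a\<in>UNIV. ((if a = j then 1 else 0) + (if a = k then y else 0)) * F a) = F j + y * F k"
      for F :: "'n \<Rightarrow> complex" and y
      by (simp add: distrib_right sum.distrib if_distrib[of "\<lambda>x. x * _"] cong: if_cong)
    have "(\<Sum>a\<in>UNIV. \<Sum>b\<in>UNIV. ?v $ a * cnj (?v $ b) * D $ a $ b) =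
       (\<Sum>a\<in>UNIV. ((if a = j then 1 else 0) + (if a = k then z else 0)) *
         (\<Sum>b\<in>UNIV. ((if b = j then 1 else 0) + (if b = k then cnj z else 0)) * D $ a $ b))"
      unfolding sum_distrib_left by (intro sum.cong refl) (simp add: mult.assoc if_distrib[of cnj])
    also have "\<dots> = D $ j $ j + cnj z * D $ j $ k + z * D $ k $ j + z * cnj z * D $ k $ k"
      unfolding pick by (simp add: algebra_simps)
    finally have "(\<Sum>a\<in>UNIV. \<Sum>b\<in>UNIV. ?v $ a * cnj (?v $ b) * D $ a $ b) =
       D $ j $ j + cnj z * D $ j $ k + z * D $ k $ j + z * cnj z * D $ k $ k" .
    with assms[of ?v] show ?thesis by simp
  qed
  have diag: "D $ j $ j = 0" for j using eq[of j 0 j] by simp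
  have "D $ j $ k = 0" for j k
  proof -
    from eq[of j 1 k] have 1: "D $ j $ k + D $ k $ j = 0" by (simp add: diag)
    from eq[of j \<i> k] have "\<i> * (D $ k $ j - D $ j $ k) = 0" by (simp add: diag algebra_simps)
    with 1 show ?thesis by simp
  qed
  thus ?thesis by (simp add: vec_eq_iff)
qed

text \<open>
  Both sides are the value at the matrix unit \<open>E\<^sub>j\<^sub>k\<close> of a complex linear functional of the direction.
  The functionals agree on projections, in particular on all \<open>v v\<^sup>* / |v|\<^sup>2\<close>, and these span the
  space of matrices.
\<close>

theorem integration_by_parts:
  fixes w \<phi> :: "complex^'n^'n \<Rightarrow> complex"
  assumes M: "haar_prob_measure M" and w: "has_gradient w W" and \<phi>: "has_gradient \<phi> \<Phi>"
  shows "(LINT g|M. W g $ k $ j * cnj (\<phi> g)) = (LINT g|M. w g * cnj (\<Phi> g $ j $ k))"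
proof -
  define D :: "complex^'n^'n" where
    "D = (\<chi> a b. (LINT g|M. W g $ b $ a * cnj (\<phi> g)) - (LINT g|M. w g * cnj (\<Phi> g $ a $ b)))"
  note cont = has_gradient_continuous[OF w] has_gradient_continuous[OF \<phi>]
  note int = haar_integrable[OF M] continuous_intros cont
  have "(\<Sum>a\<in>UNIV. \<Sum>b\<in>UNIV. v $ a * cnj (v $ b) * D $ a $ b) = 0" for v :: "complex^'n"
  proof (cases "v = 0")
    case False
    define s where "s = (\<Sum>a\<in>UNIV. v $ a * cnj (v $ a))"
    have s: "s = of_real (\<Sum>a\<in>UNIV. (norm (v $ a))\<^sup>2)"
      by (simp add: s_def complex_norm_square del: of_real_power)
    have "(\<Sum>a\<in>UNIV. (norm (v $ a))\<^sup>2) \<noteq> 0"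
      using False by (subst sum_nonneg_eq_0_iff) (auto simp: vec_eq_iff)
    hence s0: "s \<noteq> 0" unfolding s by (simp only: of_real_eq_0_iff not_False_eq_True)
    have cs: "cnj s = s" unfolding s by (rule complex_cnj_complex_of_real)
    define Q :: "complex^'n^'n" where "Q = (\<chi> a b. v $ a * cnj (v $ b) / s)"
    have QQ: "Q ** Q = Q"
    proof -
      have "(\<Sum>c\<in>UNIV. v $ a * cnj (v $ c) / s * (v $ c * cnj (v $ b) / s)) = v $ a * cnj (v $ b) / s" for a b
      proof -
        have "(\<Sum>c\<in>UNIV. v $ a * cnj (v $ c) / s * (v $ c * cnj (v $ b) / s)) =
          (\<Sum>c\<in>UNIV. (v $ a * cnj (v $ b) / s / s) * (v $ c * cnj (v $ c)))"
          by (rule sum.cong) (auto simp: divide_simps)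
        also have "\<dots> = (v $ a * cnj (v $ b) / s / s) * s"
          by (simp only: s_def sum_distrib_left)
        finally have "(\<Sum>c\<in>UNIV. v $ a * cnj (v $ c) / s * (v $ c * cnj (v $ b) / s)) = (v $ a * cnj (v $ b) / s / s) * s" .
        thus ?thesis using s0 by simp
      qed
      thus ?thesis by (simp add: Q_def matrix_matrix_mult_def vec_eq_iff)
    qed
    have Qc: "conj_transpose Q = Q"
      by (simp add: Q_def conj_transpose_def vec_eq_iff cs mult.commute)
    have cQ: "cnj (Q $ a $ b) = Q $ b $ a" for a b
      by (simp add: Q_def cs mult.commute)
    have "(\<Sum>a\<in>UNIV. \<Sum>b\<in>UNIV. Q $ a $ b * D $ a $ b) =
      (\<Sum>a\<in>UNIV. \<Sum>b\<in>UNIV. Q $ a $ b * (LINT g|M. W g $ b $ a * cnj (\<phi> g)))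
      - (\<Sum>a\<in>UNIV. \<Sum>b\<in>UNIV. Q $ b $ a * (LINT g|M. w g * cnj (\<Phi> g $ b $ a)))"
      by (subst (3) sum.swap) (simp add: D_def right_diff_distrib sum_subtractf)
    also have "(\<Sum>a\<in>UNIV. \<Sum>b\<in>UNIV. Q $ a $ b * (LINT g|M. W g $ b $ a * cnj (\<phi> g))) =
       (LINT g|M. (\<Sum>a\<in>UNIV. \<Sum>b\<in>UNIV. Q $ a $ b * W g $ b $ a) * cnj (\<phi> g))"
    proof -
      have "(LINT g|M. (\<Sum>a\<in>UNIV. \<Sum>b\<in>UNIV. Q $ a $ b * (W g $ b $ a * cnj (\<phi> g)))) =
        (\<Sum>a\<in>UNIV. \<Sum>b\<in>UNIV. Q $ a $ b * (LINT g|M. W g $ b $ a * cnj (\<phi> g)))"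
        by (subst Bochner_Integration.integral_sum, intro int,
            subst Bochner_Integration.integral_sum, intro int, simp)
      thus ?thesis by (simp add: sum_distrib_right mult.assoc)
    qed
    also have "(\<Sum>a\<in>UNIV. \<Sum>b\<in>UNIV. Q $ b $ a * (LINT g|M. w g * cnj (\<Phi> g $ b $ a))) =
       (LINT g|M. w g * cnj (\<Sum>a\<in>UNIV. \<Sum>b\<in>UNIV. Q $ a $ b * \<Phi> g $ b $ a))"
    proof -
      have "(LINT g|M. (\<Sum>a\<in>UNIV. \<Sum>b\<in>UNIV. Q $ b $ a * (w g * cnj (\<Phi> g $ b $ a)))) =
        (\<Sum>a\<in>UNIV. \<Sum>b\<in>UNIV. Q $ b $ a * (LINT g|M. w g * cnj (\<Phi> g $ b $ a)))"
        by (subst Bochner_Integration.integral_sum, intro int,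
            subst Bochner_Integration.integral_sum, intro int, simp)
      thus ?thesis by (simp add: sum_distrib_left cQ algebra_simps)
    qed
    finally have "(\<Sum>a\<in>UNIV. \<Sum>b\<in>UNIV. Q $ a $ b * D $ a $ b) = 0"
      using integration_by_parts_projection[OF M w \<phi> QQ Qc] by simp
    moreover have "v $ a * cnj (v $ b) * D $ a $ b = s * (Q $ a $ b * D $ a $ b)" for a b
      using s0 by (simp add: Q_def)
    ultimately show ?thesis by (simp only: sum_distrib_left[symmetric] mult_zero_right)
  qed simp
  hence "D = 0" by (rule sesquilinear_form_zero_imp_zero)
  hence "D $ j $ k = 0" by simp
  thus ?thesis by (simp add: D_def)
qed

section \<open>Calculus of gradients\<close>

lemma has_gradient_const: "has_gradient (\<lambda>_. c) (\<lambda>_. 0)"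
  by (simp add: has_gradient_def)

lemma has_gradient_add:
  assumes "has_gradient f V" "has_gradient f' V'"
  shows "has_gradient (\<lambda>g. f g + f' g) (\<lambda>g. V g + V' g)"
  unfolding has_gradient_def
proof (intro conjI allI)
  note cont = has_gradient_continuous[OF assms(1)] has_gradient_continuous[OF assms(2)]
  show "continuous_on UNIV (\<lambda>g. f g + f' g)" "continuous_on UNIV (\<lambda>g. V g + V' g)"
    by (intro continuous_intros cont)+
  fix X g
  have "((\<lambda>z. f (perturb X z ** g) + f' (perturb X z ** g)) has_field_derivative
      (\<Sum>a\<in>UNIV. \<Sum>b\<in>UNIV. X $ a $ b * V g $ b $ a) + (\<Sum>a\<in>UNIV. \<Sum>b\<in>UNIV. X $ a $ b * V' g $ b $ a)) (at 0)"
    using assms unfolding has_gradient_def by (intro DERIV_add) auto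
  thus "((\<lambda>z. f (perturb X z ** g) + f' (perturb X z ** g)) has_field_derivative
      (\<Sum>a\<in>UNIV. \<Sum>b\<in>UNIV. X $ a $ b * (V g + V' g) $ b $ a)) (at 0)"
    by (simp add: sum.distrib distrib_left)
qed

lemma has_gradient_mult:
  assumes "has_gradient f V" "has_gradient f' V'"
  shows "has_gradient (\<lambda>g. f g * f' g) (\<lambda>g. \<chi> i j. f g * V' g $ i $ j + f' g * V g $ i $ j)"
  unfolding has_gradient_def
proof (intro conjI allI)
  note cont = has_gradient_continuous[OF assms(1)] has_gradient_continuous[OF assms(2)]
  show "continuous_on UNIV (\<lambda>g. f g * f' g)"
       "continuous_on UNIV (\<lambda>g. \<chi> i j. f g * V' g $ i $ j + f' g * V g $ i $ j)"
    by (intro continuous_intros cont)+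
  fix X g
  have "((\<lambda>z. f (perturb X z ** g) * f' (perturb X z ** g)) has_field_derivative
      ((\<Sum>a\<in>UNIV. \<Sum>b\<in>UNIV. X $ a $ b * V g $ b $ a) * f' (perturb X 0 ** g)
     + (\<Sum>a\<in>UNIV. \<Sum>b\<in>UNIV. X $ a $ b * V' g $ b $ a) * f (perturb X 0 ** g))) (at 0)"
    using assms unfolding has_gradient_def by (intro DERIV_mult) auto
  moreover have "((\<Sum>a\<in>UNIV. \<Sum>b\<in>UNIV. X $ a $ b * V g $ b $ a) * f' (perturb X 0 ** g)
     + (\<Sum>a\<in>UNIV. \<Sum>b\<in>UNIV. X $ a $ b * V' g $ b $ a) * f (perturb X 0 ** g)) =
     (\<Sum>a\<in>UNIV. \<Sum>b\<in>UNIV. X $ a $ b * (\<chi> i j. f g * V' g $ i $ j + f' g * V g $ i $ j) $ b $ a)"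
    by (simp add: sum.distrib sum_distrib_left sum_distrib_right algebra_simps)
  ultimately show "((\<lambda>z. f (perturb X z ** g) * f' (perturb X z ** g)) has_field_derivative
     (\<Sum>a\<in>UNIV. \<Sum>b\<in>UNIV. X $ a $ b * (\<chi> i j. f g * V' g $ i $ j + f' g * V g $ i $ j) $ b $ a)) (at 0)"
    by simp
qed

lemma has_gradient_sum:
  assumes "\<And>x. x \<in> A \<Longrightarrow> has_gradient (f x) (V x)"
  shows "has_gradient (\<lambda>g. \<Sum>x\<in>A. f x g) (\<lambda>g. \<Sum>x\<in>A. V x g)"
  unfolding has_gradient_def
proof (intro conjI allI)
  show "continuous_on UNIV (\<lambda>g. \<Sum>x\<in>A. f x g)" "continuous_on UNIV (\<lambda>g. \<Sum>x\<in>A. V x g)"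
    using assms by (auto intro!: continuous_intros intro: has_gradient_continuous)
  fix X g
  have "((\<lambda>z. \<Sum>x\<in>A. f x (perturb X z ** g)) has_field_derivative
      (\<Sum>x\<in>A. \<Sum>a\<in>UNIV. \<Sum>b\<in>UNIV. X $ a $ b * V x g $ b $ a)) (at 0)"
    using assms unfolding has_gradient_def by (intro DERIV_sum) auto
  moreover have "(\<Sum>x\<in>A. \<Sum>a\<in>UNIV. \<Sum>b\<in>UNIV. X $ a $ b * V x g $ b $ a) =
      (\<Sum>a\<in>UNIV. \<Sum>b\<in>UNIV. X $ a $ b * (\<Sum>x\<in>A. V x g) $ b $ a)"
    by (simp add: sum_component sum_distrib_left sum.swap[of _ _ A])
  ultimately show "((\<lambda>z. \<Sum>x\<in>A. f x (perturb X z ** g)) has_field_derivative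
      (\<Sum>a\<in>UNIV. \<Sum>b\<in>UNIV. X $ a $ b * (\<Sum>x\<in>A. V x g) $ b $ a)) (at 0)" by simp
qed

lemma has_gradient_cong:
  assumes "has_gradient f V" "\<And>g. f g = f' g" "\<And>g i j. V g $ i $ j = V' g $ i $ j"
  shows "has_gradient f' V'"
proof -
  have "f' = f" "V' = V" using assms by (auto simp: fun_eq_iff vec_eq_iff)
  thus ?thesis using assms by simp
qed

lemma has_gradient_cmult:
  assumes "has_gradient f V"
  shows "has_gradient (\<lambda>g. c * f g) (\<lambda>g. \<chi> i j. c * V g $ i $ j)"
  by (rule has_gradient_cong[OF has_gradient_mult[OF has_gradient_const assms]]) auto

lemma has_gradient_entry:
  "has_gradient (\<lambda>g :: complex^'n^'n. g $ i $ j) (\<lambda>g. \<chi> b a. if a = i then g $ b $ j else 0)"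
  unfolding has_gradient_def
proof (intro conjI allI)
  show "continuous_on UNIV (\<lambda>g :: complex^'n^'n. g $ i $ j)" by (intro continuous_intros)
  show "continuous_on UNIV (\<lambda>g :: complex^'n^'n. \<chi> b a. if a = i then g $ b $ j else 0)"
  proof (intro continuous_on_vec_lambda)
    show "continuous_on UNIV (\<lambda>g :: complex^'n^'n. if a = i then g $ b $ j else 0)" for a b
      by (cases "a = i") (auto intro!: continuous_intros)
  qed
  fix X g :: "complex^'n^'n"
  have "(\<Sum>a\<in>UNIV. \<Sum>b\<in>UNIV. X $ a $ b * (\<chi> b a. if a = i then g $ b $ j else 0) $ b $ a)
     = (\<Sum>a\<in>UNIV. if a = i then (X ** g) $ i $ j else 0)"
    by (intro sum.cong refl) (auto simp: matrix_matrix_mult_def)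
  hence "(\<Sum>a\<in>UNIV. \<Sum>b\<in>UNIV. X $ a $ b * (\<chi> b a. if a = i then g $ b $ j else 0) $ b $ a) = (X ** g) $ i $ j"
    by simp
  thus "((\<lambda>z. (perturb X z ** g) $ i $ j) has_field_derivative
     (\<Sum>a\<in>UNIV. \<Sum>b\<in>UNIV. X $ a $ b * (\<chi> b a. if a = i then g $ b $ j else 0) $ b $ a)) (at 0)"
    unfolding perturb_mult_entry by (auto intro!: derivative_eq_intros)
qed

lemma matrix_power_add: "matrix_power g (m + n) = matrix_power g m ** matrix_power g n"
  by (induction m) (simp_all add: matrix_mul_assoc)

text \<open>
  The product rule: the derivative of \<open>g\<^sup>k\<close> in the direction \<open>X g\<close> is
  \<open>\<Sum>\<^sub>r g\<^sup>r X g\<^sup>k\<^sup>-\<^sup>r\<close>, summed over \<open>r < k\<close>.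
\<close>

lemma has_gradient_matrix_power_entry:
  "has_gradient (\<lambda>g :: complex^'n^'n. matrix_power g k $ i $ j)
     (\<lambda>g. \<chi> b a. \<Sum>r<k. matrix_power g r $ i $ a * matrix_power g (k - r) $ b $ j)"
proof (induction k arbitrary: i j)
  case 0
  show ?case by (rule has_gradient_cong[OF has_gradient_const]) auto
next
  case (Suc k)
  show ?case
  proof (rule has_gradient_cong[OF has_gradient_sum[of UNIV, OF has_gradient_mult[OF has_gradient_entry Suc.IH]]])
    show "(\<Sum>x\<in>UNIV. g $ i $ x * matrix_power g k $ x $ j) = matrix_power g (Suc k) $ i $ j" for g :: "complex^'n^'n"
      by (simp add: matrix_matrix_mult_def)
    fix g :: "complex^'n^'n" and b a
    have "(\<Sum>x\<in>UNIV. \<Sum>r<k. g $ i $ x * (matrix_power g r $ x $ a * matrix_power g (k - r) $ b $ j)) =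
      (\<Sum>r<k. (\<Sum>x\<in>UNIV. g $ i $ x * matrix_power g r $ x $ a) * matrix_power g (k - r) $ b $ j)"
      by (subst sum.swap) (simp add: sum_distrib_right mult.assoc)
    moreover have "(\<Sum>x\<in>UNIV. matrix_power g k $ x $ j * (if a = i then g $ b $ x else 0)) =
       (mat 1 :: complex^'n^'n) $ i $ a * matrix_power g (Suc k) $ b $ j"
      by (auto simp: mat_def matrix_matrix_mult_def mult.commute intro!: sum.cong)
    ultimately show "(\<Sum>x\<in>UNIV. (\<chi> ia ja. g $ i $ x *
        (\<chi> b a. \<Sum>r<k. matrix_power g r $ x $ a * matrix_power g (k - r) $ b $ j) $ ia $ ja +
        matrix_power g k $ x $ j * (\<chi> b a. if a = i then g $ b $ x else 0) $ ia $ ja)) $ b $ a =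
      (\<chi> b a. \<Sum>r<Suc k. matrix_power g r $ i $ a * matrix_power g (Suc k - r) $ b $ j) $ b $ a"
      by (subst sum.lessThan_Suc_shift) (simp add: sum_component sum.distrib sum_distrib_left matrix_matrix_mult_def add.commute)
  qed
qed

section \<open>Power sums and Newton polynomials\<close>

definition power_trace :: "nat \<Rightarrow> complex^'n^'n \<Rightarrow> complex" where
  "power_trace k g = trace (matrix_power g k)"

lemma power_trace_0: "power_trace 0 (g :: complex^'n^'n) = of_nat CARD('n)"
  by (simp add: power_trace_def trace_def mat_def)

lemma has_gradient_power_trace:
  "has_gradient (power_trace k) (\<lambda>g. \<chi> i j. of_nat k * matrix_power g k $ i $ j)"
proof (rule has_gradient_cong[OF has_gradient_sum[of UNIV, OF has_gradient_matrix_power_entry]])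
  show "(\<Sum>x\<in>UNIV. matrix_power g k $ x $ x) = power_trace k g" for g :: "complex^'n^'n"
    by (simp add: power_trace_def trace_def)
  fix g :: "complex^'n^'n" and b a
  have "(\<Sum>x\<in>UNIV. \<Sum>r<k. matrix_power g r $ x $ a * matrix_power g (k - r) $ b $ x) =
     (\<Sum>r<k. (matrix_power g (k - r) ** matrix_power g r) $ b $ a)"
    by (subst sum.swap) (simp add: matrix_matrix_mult_def mult.commute)
  thus "(\<Sum>x\<in>UNIV. \<chi> b a. \<Sum>r<k. matrix_power g r $ x $ a * matrix_power g (k - r) $ b $ x) $ b $ a =
    (\<chi> i j. of_nat k * matrix_power g k $ i $ j) $ b $ a"
    by (simp add: sum_component flip: matrix_power_add)
qed

lemma trace_matrix_power_mult:
  "(\<Sum>i\<in>UNIV. \<Sum>j\<in>UNIV. matrix_power g k $ i $ j * matrix_power g l $ j $ i) = power_trace (k + l) g"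
  by (simp add: power_trace_def trace_def matrix_power_add matrix_matrix_mult_def)

text \<open>
  Newton's identities as a definition: for \<open>s = 1\<close> this is the complete symmetric polynomial \<open>h\<^sub>n\<close>
  of the eigenvalues of \<open>g\<close>, for \<open>s = -1\<close> the signed elementary symmetric polynomial
  \<open>(-1)\<^sup>n e\<^sub>n\<close>.  The parameter \<open>s\<close> lets both be treated at once.
\<close>

function newton :: "complex \<Rightarrow> nat \<Rightarrow> complex^'n^'n \<Rightarrow> complex" where
  "newton s 0 g = 1"
| "newton s (Suc n) g = s / of_nat (Suc n) * (\<Sum>k=1..Suc n. power_trace k g * newton s (Suc n - k) g)"
  by pat_completeness auto
termination by (relation "Wellfounded.measure (\<lambda>(s, n, g). n)") auto

declare newton.simps(2) [simp del]

lemma newton_recursion: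
  "s * (\<Sum>k=1..n. power_trace k g * newton s (n - k) g) = of_nat n * newton s n g"
  by (cases n) (simp_all add: newton.simps(2) del: of_nat_Suc)

lemma sum_triangle_swap:
  fixes f :: "nat \<Rightarrow> nat \<Rightarrow> 'a::comm_monoid_add"
  shows "(\<Sum>k=1..n. \<Sum>l=1..n - k. f k l) = (\<Sum>l=1..n. \<Sum>k=1..n - l. f k l)"
proof -
  have "(\<Sum>k=1..n. \<Sum>l=1..n - k. f k l) = (\<Sum>k=1..n. \<Sum>l\<in>{l\<in>{1..n}. k + l \<le> n}. f k l)"
    by (intro sum.cong refl arg_cong[where f = "sum _"]) auto
  also have "\<dots> = (\<Sum>l=1..n. \<Sum>k\<in>{k\<in>{1..n}. k + l \<le> n}. f k l)"
    by (rule sum.swap_restrict) auto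
  also have "\<dots> = (\<Sum>l=1..n. \<Sum>k=1..n - l. f k l)"
    by (intro sum.cong refl arg_cong[where f = "sum _"]) auto
  finally show ?thesis .
qed

text \<open>
  Differentiating Newton's identity gives, by induction, a double sum over \<open>k + l \<le> n\<close>; summing over
  \<open>k\<close> first, Newton's identity collapses it again.
\<close>

lemma has_gradient_newton:
  "has_gradient (newton s n) (\<lambda>g. \<chi> i j. s * (\<Sum>k=1..n. matrix_power g k $ i $ j * newton s (n - k) g))"
proof (induction n rule: less_induct)
  case (less n)
  show ?case
  proof (cases n)
    case 0
    show ?thesis unfolding 0
      by (rule has_gradient_cong[OF has_gradient_const]) auto
  next
    case (Suc m)
    have n: "n > 0" by (simp add: Suc)
    show ?thesis
    proof (rule has_gradient_cong[OF has_gradient_cmult[where c = "s / of_nat n", OF has_gradient_sum[of "{1..n}",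
        OF has_gradient_mult[OF has_gradient_power_trace less.IH]]]])
      show "n - k < n" if "k \<in> {1..n}" for k using that n by auto
      show "s / of_nat n * (\<Sum>k = 1..n. power_trace k g * newton s (n - k) g) = newton s n g" for g :: "complex^'n^'n"
        using newton_recursion[where s = s and n = n and g = g] n by (simp add: field_simps)
      fix g :: "complex^'n^'n" and i j
      let ?P = "\<lambda>k. matrix_power g k $ i $ j"
      have "(\<Sum>k=1..n. power_trace k g * (s * (\<Sum>l=1..n - k. ?P l * newton s (n - k - l) g))) =
            (\<Sum>k=1..n. \<Sum>l=1..n - k. s * (?P l * (power_trace k g * newton s (n - k - l) g)))"
        by (simp add: sum_distrib_left mult_ac)
      also have "\<dots> = (\<Sum>l=1..n. \<Sum>k=1..n - l. s * (?P l * (power_trace k g * newton s (n - k - l) g)))"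
        by (rule sum_triangle_swap)
      also have "\<dots> = (\<Sum>l=1..n. ?P l * (s * (\<Sum>k=1..n - l. power_trace k g * newton s (n - l - k) g)))"
        by (simp add: sum_distrib_left mult_ac add.commute)
      also have "\<dots> = (\<Sum>l=1..n. ?P l * (of_nat (n - l) * newton s (n - l) g))"
        by (simp only: newton_recursion)
      finally have 1: "(\<Sum>k=1..n. power_trace k g * (s * (\<Sum>l=1..n - k. ?P l * newton s (n - k - l) g))) = \<dots>" .
      have "(\<Sum>k=1..n. power_trace k g * (s * (\<Sum>l=1..n - k. ?P l * newton s (n - k - l) g)) +
               newton s (n - k) g * (of_nat k * ?P k)) =
            (\<Sum>k=1..n. of_nat n * (?P k * newton s (n - k) g))"
        unfolding sum.distrib 1 unfolding sum.distrib[symmetric]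
        by (intro sum.cong refl) (auto simp: of_nat_diff algebra_simps)
      thus "(\<chi> ia ja. s / of_nat n * (\<Sum>x = 1..n. \<chi> i j. power_trace x g *
           (\<chi> i j. s * (\<Sum>k = 1..n - x. matrix_power g k $ i $ j * newton s (n - x - k) g)) $ i $ j +
            newton s (n - x) g * (\<chi> i j. of_nat x * matrix_power g x $ i $ j) $ i $ j) $ ia $ ja) $ i $ j =
          (\<chi> i j. s * (\<Sum>k = 1..n. matrix_power g k $ i $ j * newton s (n - k) g)) $ i $ j"
        using n by (simp add: sum_component sum_distrib_left[symmetric])
    qed
  qed
qed

section \<open>The Casimir operator and the Green identity\<close>

text \<open>
  \<open>F\<close> is the divergence of the gradient, \<open>\<Sum>\<^sub>i\<^sub>j E\<^sub>i\<^sub>j E\<^sub>j\<^sub>i f\<close> for the derivations \<open>E\<^sub>i\<^sub>j\<close> along the matrix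
  units, which is the Casimir operator of \<open>gl(N)\<close>.  The gradient \<open>W\<close> is kept as a parameter since
  the Green identity needs it.
\<close>

definition has_laplacian ::
  "(complex^'n^'n \<Rightarrow> complex) \<Rightarrow> (complex^'n^'n \<Rightarrow> complex^'n^'n) \<Rightarrow> (complex^'n^'n \<Rightarrow> complex) \<Rightarrow> bool" where
  "has_laplacian f W F \<longleftrightarrow> has_gradient f W \<and>
     (\<exists>V. (\<forall>i j. has_gradient (\<lambda>g. W g $ i $ j) (V i j)) \<and>
          (\<forall>g. F g = (\<Sum>i\<in>UNIV. \<Sum>j\<in>UNIV. V i j g $ j $ i)))"

lemma has_laplacianE:
  assumes "has_laplacian f W F"
  obtains V where "has_gradient f W" "\<And>i j. has_gradient (\<lambda>g. W g $ i $ j) (V i j)"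
    "\<And>g. F g = (\<Sum>i\<in>UNIV. \<Sum>j\<in>UNIV. V i j g $ j $ i)"
proof -
  from assms obtain V where f: "has_gradient f W"
    and V: "\<forall>i j. has_gradient (\<lambda>g. W g $ i $ j) (V i j)"
           "\<forall>g. F g = (\<Sum>i\<in>UNIV. \<Sum>j\<in>UNIV. V i j g $ j $ i)"
    unfolding has_laplacian_def by (elim conjE exE)
  show ?thesis
    by (rule that[OF f V(1)[THEN spec, THEN spec] V(2)[THEN spec]])
qed

lemma has_laplacianI:
  assumes "has_gradient f W" "\<And>i j. has_gradient (\<lambda>g. W g $ i $ j) (V i j)"
    "\<And>g. F g = (\<Sum>i\<in>UNIV. \<Sum>j\<in>UNIV. V i j g $ j $ i)"
  shows "has_laplacian f W F"
  unfolding has_laplacian_def by (intro conjI exI[of _ V] allI assms)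

text \<open>
  Integration by parts applied to each entry of the gradient of \<open>f\<close>.
\<close>

theorem green_identity:
  fixes M :: "(complex^'n^'n) measure"
  assumes M: "haar_prob_measure M" and f: "has_laplacian f W F" and \<phi>: "has_gradient \<phi> \<Phi>"
  shows "(LINT g|M. F g * cnj (\<phi> g)) = (\<Sum>i\<in>UNIV. \<Sum>j\<in>UNIV. LINT g|M. W g $ i $ j * cnj (\<Phi> g $ i $ j))"
proof -
  obtain V where V: "\<And>i j. has_gradient (\<lambda>g. W g $ i $ j) (V i j)"
    and F: "\<And>g. F g = (\<Sum>i\<in>UNIV. \<Sum>j\<in>UNIV. V i j g $ j $ i)"
    by (rule has_laplacianE[OF f]) (rule that)
  note cont = has_gradient_continuous(2)[OF V] has_gradient_continuous[OF \<phi>]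
  note int = haar_integrable[OF M] continuous_intros cont
  have "(LINT g|M. F g * cnj (\<phi> g)) = (LINT g|M. (\<Sum>i\<in>UNIV. \<Sum>j\<in>UNIV. V i j g $ j $ i * cnj (\<phi> g)))"
    by (simp only: F sum_distrib_right)
  also have "\<dots> = (\<Sum>i\<in>UNIV. \<Sum>j\<in>UNIV. LINT g|M. V i j g $ j $ i * cnj (\<phi> g))"
    by (subst Bochner_Integration.integral_sum, intro int,
        subst Bochner_Integration.integral_sum, intro int, rule refl)
  also have "\<dots> = (\<Sum>i\<in>UNIV. \<Sum>j\<in>UNIV. LINT g|M. W g $ i $ j * cnj (\<Phi> g $ i $ j))"
    by (intro sum.cong refl integration_by_parts[OF M V \<phi>])
  finally show ?thesis .
qed

lemma has_laplacian_cong: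
  assumes "has_laplacian f W F" "\<And>g. f g = f' g" "\<And>g i j. W g $ i $ j = W' g $ i $ j" "\<And>g. F g = F' g"
  shows "has_laplacian f' W' F'"
proof -
  have "f' = f" "W' = W" "F' = F" using assms by (auto simp: fun_eq_iff vec_eq_iff)
  thus ?thesis using assms by simp
qed

text \<open>
  The mixed term comes from differentiating \<open>f\<close> in \<open>f \<nabla>f'\<close> and \<open>f'\<close> in \<open>f' \<nabla>f\<close>; both
  contributions are equal.
\<close>

lemma has_laplacian_mult:
  assumes "has_laplacian f W F" "has_laplacian f' W' F'"
  shows "has_laplacian (\<lambda>g. f g * f' g) (\<lambda>g. \<chi> i j. f g * W' g $ i $ j + f' g * W g $ i $ j)
     (\<lambda>g. f g * F' g + f' g * F g + 2 * (\<Sum>i\<in>UNIV. \<Sum>j\<in>UNIV. W g $ i $ j * W' g $ j $ i))"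
proof -
  obtain V where V: "has_gradient f W" "\<And>i j. has_gradient (\<lambda>g. W g $ i $ j) (V i j)"
    and F: "\<And>g. F g = (\<Sum>i\<in>UNIV. \<Sum>j\<in>UNIV. V i j g $ j $ i)"
    by (rule has_laplacianE[OF assms(1)]) (rule that)
  obtain V' where V': "has_gradient f' W'" "\<And>i j. has_gradient (\<lambda>g. W' g $ i $ j) (V' i j)"
    and F': "\<And>g. F' g = (\<Sum>i\<in>UNIV. \<Sum>j\<in>UNIV. V' i j g $ j $ i)"
    by (rule has_laplacianE[OF assms(2)]) (rule that)
  show ?thesis
  proof (rule has_laplacianI[OF has_gradient_mult[OF V(1) V'(1)]])
    fix i j
    show "has_gradient (\<lambda>g. (\<chi> i j. f g * W' g $ i $ j + f' g * W g $ i $ j) $ i $ j)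
       (\<lambda>g. \<chi> a b. f g * V' i j g $ a $ b + W' g $ i $ j * W g $ a $ b +
                   (f' g * V i j g $ a $ b + W g $ i $ j * W' g $ a $ b))"
      by (rule has_gradient_cong[OF has_gradient_add[OF
            has_gradient_mult[OF V(1) V'(2)[of i j]] has_gradient_mult[OF V'(1) V(2)[of i j]]]]) auto
  next
    fix g
    have "(\<Sum>i\<in>UNIV. \<Sum>j\<in>UNIV. W' g $ i $ j * W g $ j $ i) = (\<Sum>i\<in>UNIV. \<Sum>j\<in>UNIV. W g $ i $ j * W' g $ j $ i)"
      by (subst sum.swap) (simp add: mult.commute)
    thus "f g * F' g + f' g * F g + 2 * (\<Sum>i\<in>UNIV. \<Sum>j\<in>UNIV. W g $ i $ j * W' g $ j $ i) =
      (\<Sum>i\<in>UNIV. \<Sum>j\<in>UNIV. (\<chi> a b. f g * V' i j g $ a $ b + W' g $ i $ j * W g $ a $ b +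
                   (f' g * V i j g $ a $ b + W g $ i $ j * W' g $ a $ b)) $ j $ i)"
      by (simp add: F F' sum.distrib sum_distrib_left)
  qed
qed

lemma has_laplacian_sum:
  assumes "\<And>x. x \<in> A \<Longrightarrow> has_laplacian (f x) (W x) (F x)"
  shows "has_laplacian (\<lambda>g. \<Sum>x\<in>A. f x g) (\<lambda>g. \<Sum>x\<in>A. W x g) (\<lambda>g. \<Sum>x\<in>A. F x g)"
proof -
  obtain V where V: "\<And>x i j. x \<in> A \<Longrightarrow> has_gradient (\<lambda>g. W x g $ i $ j) (V x i j)"
    and F: "\<And>x g. x \<in> A \<Longrightarrow> F x g = (\<Sum>i\<in>UNIV. \<Sum>j\<in>UNIV. V x i j g $ j $ i)"
  proof -
    have "\<forall>x\<in>A. \<exists>V. (\<forall>i j. has_gradient (\<lambda>g. W x g $ i $ j) (V i j)) \<and>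
        (\<forall>g. F x g = (\<Sum>i\<in>UNIV. \<Sum>j\<in>UNIV. V i j g $ j $ i))"
      using assms by (simp add: has_laplacian_def)
    from bchoice[OF this] show ?thesis using that by blast
  qed
  show ?thesis
  proof (rule has_laplacianI)
    show "has_gradient (\<lambda>g. \<Sum>x\<in>A. f x g) (\<lambda>g. \<Sum>x\<in>A. W x g)"
      using assms by (intro has_gradient_sum) (auto simp: has_laplacian_def)
    show "has_gradient (\<lambda>g. (\<Sum>x\<in>A. W x g) $ i $ j) (\<lambda>g. \<Sum>x\<in>A. V x i j g)" for i j
      unfolding sum_component by (intro has_gradient_sum V)
    show "(\<Sum>x\<in>A. F x g) = (\<Sum>i\<in>UNIV. \<Sum>j\<in>UNIV. (\<Sum>x\<in>A. V x i j g) $ j $ i)" for g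
      by (simp add: F sum_component sum.swap[of _ _ A])
  qed
qed

section \<open>The Casimir operator on Newton polynomials\<close>

lemma sum_triangle_diagonals:
  fixes f :: "nat \<Rightarrow> nat \<Rightarrow> 'a::comm_monoid_add"
  shows "(\<Sum>k=1..n. \<Sum>l=1..n - k. f k l) = (\<Sum>m=1..n. \<Sum>r=1..<m. f r (m - r))"
  unfolding sum.Sigma[OF finite_atLeastAtMost ballI[OF finite_atLeastAtMost]]
    sum.Sigma[OF finite_atLeastAtMost ballI[OF finite_atLeastLessThan]]
  by (rule sum.reindex_bij_witness[where i = "\<lambda>(m, r). (r, m - r)" and j = "\<lambda>(k, l). (k + l, k)"]) auto

text \<open>
  The left-hand side is the Casimir operator applied to \<open>q\<^sub>n\<close>, written in power sums.  Both double sums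
  reduce to \<open>\<Sum>\<^sub>m p\<^sub>m q\<^sub>n\<^sub>-\<^sub>m\<close> with weights: \<open>m - 1\<close> from the pairs \<open>(k, l)\<close> with \<open>k + l = m\<close>,
  and \<open>n - m\<close> from Newton's identity.  The total weight \<open>n - 1\<close> no longer depends on \<open>m\<close>, which is
  why \<open>q\<^sub>n\<close> is an eigenfunction.
\<close>

lemma newton_laplacian_identity:
  fixes p q :: "nat \<Rightarrow> complex"
  assumes rec: "\<And>n. s * (\<Sum>k=1..n. p k * q (n - k)) = of_nat n * q n" and s: "s * s = 1"
  shows "s * (\<Sum>k=1..n. s * (\<Sum>l=1..n - k. p (k + l) * q (n - k - l)) + q (n - k) * (\<Sum>r<k. p r * p (k - r)))
      = of_nat n * (p 0 + s * (of_nat n - 1)) * q n"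
proof -
  have rec': "(\<Sum>k=1..n. p k * q (n - k)) = s * (of_nat n * q n)" for n
    unfolding rec[symmetric] mult.assoc[symmetric] s by simp
  have 1: "(\<Sum>k=1..n. \<Sum>l=1..n - k. p (k + l) * q (n - k - l)) = (\<Sum>m=1..n. (of_nat m - 1) * (p m * q (n - m)))"
    unfolding sum_triangle_diagonals
    by (intro sum.cong refl) (auto simp: of_nat_diff)
  have "(\<Sum>k=1..n. q (n - k) * (\<Sum>r<k. p r * p (k - r))) =
        (\<Sum>k=1..n. p 0 * (p k * q (n - k)) + (\<Sum>r=1..<k. p r * (p (k - r) * q (n - k))))"
  proof (intro sum.cong refl)
    fix k assume "k \<in> {1..n}"
    hence "{..<k} = insert 0 {1..<k}" by auto
    thus "q (n - k) * (\<Sum>r<k. p r * p (k - r)) = p 0 * (p k * q (n - k)) + (\<Sum>r=1..<k. p r * (p (k - r) * q (n - k)))"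
      by (simp add: sum_distrib_left algebra_simps)
  qed
  also have "\<dots> = p 0 * (s * (of_nat n * q n)) + (\<Sum>k=1..n. \<Sum>r=1..<k. p r * (p (k - r) * q (n - r - (k - r))))"
    unfolding sum.distrib sum_distrib_left[symmetric] rec' by simp
  also have "(\<Sum>k=1..n. \<Sum>r=1..<k. p r * (p (k - r) * q (n - r - (k - r)))) = (\<Sum>r=1..n. \<Sum>t=1..n - r. p r * (p t * q (n - r - t)))"
    by (rule sum_triangle_diagonals[symmetric])
  also have "\<dots> = (\<Sum>r=1..n. s * (of_nat n - of_nat r) * (p r * q (n - r)))"
    unfolding sum_distrib_left[symmetric] rec' by (intro sum.cong refl) (auto simp: of_nat_diff)
  finally have 2: "(\<Sum>k=1..n. q (n - k) * (\<Sum>r<k. p r * p (k - r))) =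
      p 0 * (s * (of_nat n * q n)) + (\<Sum>r=1..n. s * (of_nat n - of_nat r) * (p r * q (n - r)))" .
  have "(\<Sum>k=1..n. s * (\<Sum>l=1..n - k. p (k + l) * q (n - k - l)) + q (n - k) * (\<Sum>r<k. p r * p (k - r))) =
     p 0 * (s * (of_nat n * q n)) +
     (\<Sum>m=1..n. s * ((of_nat m - 1) * (p m * q (n - m))) + s * (of_nat n - of_nat m) * (p m * q (n - m)))"
    unfolding sum.distrib sum_distrib_left[symmetric] 1 2 by (simp add: add_ac)
  also have "(\<Sum>m=1..n. s * ((of_nat m - 1) * (p m * q (n - m))) + s * (of_nat n - of_nat m) * (p m * q (n - m))) =
     (\<Sum>m=1..n. s * (of_nat n - 1) * (p m * q (n - m)))"
    by (intro sum.cong refl) (simp add: algebra_simps)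
  also have "\<dots> = (s * s) * (of_nat n - 1) * (of_nat n * q n)"
    unfolding sum_distrib_left[symmetric] rec' by (simp add: mult_ac)
  finally have "(\<Sum>k=1..n. s * (\<Sum>l=1..n - k. p (k + l) * q (n - k - l)) + q (n - k) * (\<Sum>r<k. p r * p (k - r))) =
     p 0 * (s * (of_nat n * q n)) + (of_nat n - 1) * (of_nat n * q n)" by (simp add: s)
  hence "s * (\<Sum>k=1..n. s * (\<Sum>l=1..n - k. p (k + l) * q (n - k - l)) + q (n - k) * (\<Sum>r<k. p r * p (k - r))) =
     (s * s) * p 0 * (of_nat n * q n) + s * (of_nat n - 1) * (of_nat n * q n)"
    by (simp only: distrib_left mult_ac)
  also have "\<dots> = of_nat n * (p 0 + s * (of_nat n - 1)) * q n"
    by (simp add: s algebra_simps)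
  finally show ?thesis .
qed

lemma sum_swap_innermost:
  fixes f :: "'a \<Rightarrow> 'b \<Rightarrow> 'c \<Rightarrow> 'd::comm_monoid_add"
  shows "(\<Sum>i\<in>I. \<Sum>j\<in>J. \<Sum>x\<in>A. f i j x) = (\<Sum>x\<in>A. \<Sum>i\<in>I. \<Sum>j\<in>J. f i j x)"
proof -
  have "(\<Sum>i\<in>I. \<Sum>j\<in>J. \<Sum>x\<in>A. f i j x) = (\<Sum>i\<in>I. \<Sum>x\<in>A. \<Sum>j\<in>J. f i j x)"
    by (intro sum.cong refl sum.swap)
  also have "\<dots> = (\<Sum>x\<in>A. \<Sum>i\<in>I. \<Sum>j\<in>J. f i j x)"
    by (rule sum.swap)
  finally show ?thesis .
qed

lemma has_laplacian_newton:
  assumes s: "s * s = 1"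
  shows "has_laplacian (newton s n :: complex^'n^'n \<Rightarrow> complex)
    (\<lambda>g. \<chi> i j. s * (\<Sum>k=1..n. matrix_power g k $ i $ j * newton s (n - k) g))
    (\<lambda>g. of_nat n * (of_nat CARD('n) + s * (of_nat n - 1)) * newton s n g)"
proof (rule has_laplacianI[OF has_gradient_newton])
  let ?P = "\<lambda>k g i j. matrix_power g k $ i $ j"
  show "has_gradient (\<lambda>g :: complex^'n^'n. (\<chi> i j. s * (\<Sum>k=1..n. ?P k g i j * newton s (n - k) g)) $ i $ j)
    (\<lambda>g. \<chi> b a. s * (\<Sum>k=1..n. ?P k g i j * (s * (\<Sum>l=1..n - k. ?P l g b a * newton s (n - k - l) g))
                     + newton s (n - k) g * (\<Sum>r<k. ?P r g i a * ?P (k - r) g b j)))" for i j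
  proof -
    have "has_gradient (\<lambda>g. ?P k g i j * newton s (n - k) g)
        (\<lambda>g. \<chi> b a. ?P k g i j * (s * (\<Sum>l=1..n - k. ?P l g b a * newton s (n - k - l) g))
                     + newton s (n - k) g * (\<Sum>r<k. ?P r g i a * ?P (k - r) g b j))" for k
      by (rule has_gradient_cong[OF has_gradient_mult[OF has_gradient_matrix_power_entry[of k i j] has_gradient_newton[of s "n - k"]]]) simp_all
    hence "has_gradient (\<lambda>g. \<Sum>k=1..n. ?P k g i j * newton s (n - k) g)
        (\<lambda>g. \<Sum>k=1..n. \<chi> b a. ?P k g i j * (s * (\<Sum>l=1..n - k. ?P l g b a * newton s (n - k - l) g))
                     + newton s (n - k) g * (\<Sum>r<k. ?P r g i a * ?P (k - r) g b j))"
      by (intro has_gradient_sum)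
    from has_gradient_cmult[where c = s, OF this] show ?thesis
      by (rule has_gradient_cong) (simp_all add: sum_component)
  qed
  fix g :: "complex^'n^'n"
  define T where "T k i j = ?P k g i j * (s * (\<Sum>l=1..n - k. ?P l g j i * newton s (n - k - l) g))
      + newton s (n - k) g * (\<Sum>r<k. ?P r g i i * ?P (k - r) g j j)" for k i j
  have cross: "(\<Sum>i\<in>UNIV. \<Sum>j\<in>UNIV. ?P k g i j * (s * (\<Sum>l=1..n - k. ?P l g j i * newton s (n - k - l) g))) =
        s * (\<Sum>l=1..n - k. power_trace (k + l) g * newton s (n - k - l) g)" for k
  proof -
    have "(\<Sum>i\<in>UNIV. \<Sum>j\<in>UNIV. ?P k g i j * (s * (\<Sum>l=1..n - k. ?P l g j i * newton s (n - k - l) g))) =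
      (\<Sum>l=1..n - k. \<Sum>i\<in>UNIV. \<Sum>j\<in>UNIV. s * newton s (n - k - l) g * (?P k g i j * ?P l g j i))"
      by (subst sum_swap_innermost[symmetric]) (simp add: sum_distrib_left mult_ac)
    thus ?thesis
      unfolding sum_distrib_left[symmetric] trace_matrix_power_mult by (simp add: sum_distrib_left mult_ac)
  qed
  have diag: "(\<Sum>i\<in>UNIV. \<Sum>j\<in>UNIV. newton s (n - k) g * (\<Sum>r<k. ?P r g i i * ?P (k - r) g j j)) =
       newton s (n - k) g * (\<Sum>r<k. power_trace r g * power_trace (k - r) g)" for k
  proof -
    have "(\<Sum>i\<in>UNIV. \<Sum>j\<in>UNIV. newton s (n - k) g * (\<Sum>r<k. ?P r g i i * ?P (k - r) g j j)) =
      (\<Sum>r<k. newton s (n - k) g * ((\<Sum>i\<in>UNIV. ?P r g i i) * (\<Sum>j\<in>UNIV. ?P (k - r) g j j)))"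
      unfolding sum_product unfolding sum_distrib_left by (rule sum_swap_innermost)
    thus ?thesis by (simp add: power_trace_def trace_def sum_distrib_left)
  qed
  have "(\<Sum>i\<in>UNIV. \<Sum>j\<in>UNIV. s * (\<Sum>k=1..n. T k i j)) = s * (\<Sum>k=1..n. \<Sum>i\<in>UNIV. \<Sum>j\<in>UNIV. T k i j)"
    unfolding sum_distrib_left by (rule sum_swap_innermost)
  also have "\<dots> =
     s * (\<Sum>k=1..n. s * (\<Sum>l=1..n - k. power_trace (k + l) g * newton s (n - k - l) g)
           + newton s (n - k) g * (\<Sum>r<k. power_trace r g * power_trace (k - r) g))"
    by (simp only: T_def sum.distrib cross diag)
  also have "\<dots> = of_nat n * (of_nat CARD('n) + s * (of_nat n - 1)) * newton s n g"
    using newton_laplacian_identity[of s "\<lambda>k. power_trace k g" "\<lambda>m. newton s m g" n, OF newton_recursion s]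
    by (simp only: power_trace_0)
  finally show "of_nat n * (of_nat CARD('n) + s * (of_nat n - 1)) * newton s n g =
    (\<Sum>i\<in>UNIV. \<Sum>j\<in>UNIV. (\<chi> b a. s * (\<Sum>k=1..n. ?P k g i j * (s * (\<Sum>l=1..n - k. ?P l g b a * newton s (n - k - l) g))
                     + newton s (n - k) g * (\<Sum>r<k. ?P r g i a * ?P (k - r) g b j))) $ j $ i)"
    by (simp add: T_def)
qed

section \<open>Signed hook Schur functions\<close>

text \<open>
  The product \<open>(-1)\<^sup>c h\<^sub>n\<^sub>-\<^sub>c e\<^sub>c\<close>, extended by 0 to \<open>c > n\<close> so that sums over \<open>c\<close> may have any
  upper limit.
\<close>

definition hook_summand :: "nat \<Rightarrow> nat \<Rightarrow> complex^'n^'n \<Rightarrow> complex" where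
  "hook_summand n c g = (if c \<le> n then newton 1 (n - c) g * newton (-1) c g else 0)"

text \<open>
  By the Pieri rule \<open>h\<^sub>n\<^sub>-\<^sub>c e\<^sub>c\<close> is the sum of the Schur functions of \<open>(n - c, 1\<^sup>c)\<close> and
  \<open>(n - c + 1, 1\<^sup>c\<^sup>-\<^sup>1)\<close>, so the partial alternating sum telescopes to \<open>(-1)\<^sup>b\<close> times the Schur function
  of the hook \<open>(n - b, 1\<^sup>b)\<close> when \<open>b < n\<close>.
\<close>

definition hook :: "nat \<Rightarrow> nat \<Rightarrow> complex^'n^'n \<Rightarrow> complex" where
  "hook n b g = (\<Sum>c\<le>b. hook_summand n c g)"

text \<open>
  Shifting \<open>k\<close> on one side and \<open>l\<close> on the other makes the double sums agree except for one row and
  one column, which Newton's identities evaluate.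
\<close>

lemma newton_cross_step:
  fixes p h e :: "nat \<Rightarrow> complex"
  assumes h: "\<And>n. (\<Sum>k=1..n. p k * h (n - k)) = of_nat n * h n"
    and e: "\<And>n. (\<Sum>k=1..n. p k * e (n - k)) = - of_nat n * e n"
  shows "(\<Sum>k=1..a. \<Sum>l=1..Suc c. p (k + l) * (h (a - k) * e (Suc c - l))) =
         (\<Sum>k=1..Suc a. \<Sum>l=1..c. p (k + l) * (h (Suc a - k) * e (c - l)))
       + of_nat (Suc a) * h (Suc a) * e c + of_nat (Suc c) * h a * e (Suc c)"
proof -
  define Y where "Y = (\<Sum>k<a. \<Sum>l<c. p (Suc (Suc (Suc (k + l)))) * (h (a - Suc k) * e (c - Suc l)))"
  have "(\<Sum>k=1..a. \<Sum>l=1..Suc c. p (k + l) * (h (a - k) * e (Suc c - l))) =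
     (\<Sum>k<a. p (Suc (Suc k)) * h (a - Suc k)) * e c + Y"
    unfolding One_nat_def sum.atLeast1_atMost_eq sum.lessThan_Suc_shift
    by (simp add: Y_def sum.distrib sum_distrib_right mult.assoc
        del: sum.lessThan_Suc)
  moreover have "(\<Sum>k=1..Suc a. \<Sum>l=1..c. p (k + l) * (h (Suc a - k) * e (c - l))) =
     h a * (\<Sum>l<c. p (Suc (Suc l)) * e (c - Suc l)) + Y"
    unfolding One_nat_def sum.atLeast1_atMost_eq sum.lessThan_Suc_shift
    by (simp add: Y_def sum.distrib sum_distrib_left mult_ac
        del: sum.lessThan_Suc)
  moreover have "of_nat (Suc a) * h (Suc a) = p 1 * h a + (\<Sum>k<a. p (Suc (Suc k)) * h (a - Suc k))"
    unfolding h[symmetric] One_nat_def sum.atLeast1_atMost_eq sum.lessThan_Suc_shift by simp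
  moreover have "of_nat (Suc c) * e (Suc c) = - (p 1 * e c + (\<Sum>k<c. p (Suc (Suc k)) * e (c - Suc k)))"
    using e[of "Suc c"] unfolding One_nat_def sum.atLeast1_atMost_eq sum.lessThan_Suc_shift
    by (simp add: minus_equation_iff del: sum.lessThan_Suc of_nat_Suc)
  moreover have "of_nat (Suc c) * h a * e (Suc c) = h a * (of_nat (Suc c) * e (Suc c))"
    by (simp only: mult_ac)
  ultimately show ?thesis by (simp only:) (simp add: algebra_simps)
qed

text \<open>
  The mixed term in the Casimir operator of the product \<open>h\<^sub>n\<^sub>-\<^sub>b e\<^sub>b\<close>, evaluated by raising the
  degree of \<open>e\<close> and lowering that of \<open>h\<close> one step at a time.
\<close>

lemma newton_cross_sum:
  fixes p h e :: "nat \<Rightarrow> complex"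
  assumes h: "\<And>n. (\<Sum>k=1..n. p k * h (n - k)) = of_nat n * h n"
    and e: "\<And>n. (\<Sum>k=1..n. p k * e (n - k)) = - of_nat n * e n"
    and "b \<le> n"
  shows "(\<Sum>k=1..n - b. \<Sum>l=1..b. p (k + l) * (h (n - b - k) * e (b - l))) =
         of_nat b * (h (n - b) * e b) + of_nat n * (\<Sum>c<b. h (n - c) * e c)"
  using \<open>b \<le> n\<close>
proof (induction b)
  case (Suc b)
  define a where "a = n - Suc b"
  have a: "n - b = Suc a" "n - Suc b = a" and n: "n = Suc a + b" using Suc.prems by (auto simp: a_def)
  have IH: "(\<Sum>k=1..Suc a. \<Sum>l=1..b. p (k + l) * (h (Suc a - k) * e (b - l))) =
         of_nat b * (h (Suc a) * e b) + of_nat n * (\<Sum>c<b. h (n - c) * e c)"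
    using Suc unfolding a by simp
  show ?case
    unfolding a newton_cross_step[of p h e, OF h e] IH sum.lessThan_Suc
    by (simp add: n algebra_simps)
qed simp

text \<open>
  The left-hand side is the form in which the gradient of the product is summed over \<open>b\<close>; the
  right-hand side is the form given by the product rule.  The coefficients \<open>x k\<close> will be entries of
  \<open>g\<^sup>k\<close>, or \<open>p\<^sub>k\<close>.
\<close>

lemma sum_hook_summand_gradient:
  assumes "c \<le> n"
  shows "(\<Sum>k=1..n. x k * (hook_summand (n - k) c g - (if k \<le> c then hook_summand (n - k) (c - k) g else 0))) =
    newton (-1) c g * (\<Sum>k=1..n - c. x k * newton 1 (n - c - k) g)
    - newton 1 (n - c) g * (\<Sum>k=1..c. x k * newton (-1) (c - k) g)"
proof -
  have "(\<Sum>k=1..n. x k * hook_summand (n - k) c g) = (\<Sum>k=1..n - c. x k * (newton 1 (n - c - k) g * newton (-1) c g))"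
  proof (rule sum.mono_neutral_cong_right)
    show "x k * hook_summand (n - k) c g = x k * (newton 1 (n - c - k) g * newton (-1) c g)" if "k \<in> {1..n - c}" for k
    proof -
      have "c \<le> n - k" "n - k - c = n - c - k" using that assms by auto
      thus ?thesis by (simp add: hook_summand_def)
    qed
  qed (auto simp: hook_summand_def)
  moreover have "(\<Sum>k=1..n. x k * (if k \<le> c then hook_summand (n - k) (c - k) g else 0)) =
     (\<Sum>k=1..c. x k * (newton 1 (n - c) g * newton (-1) (c - k) g))"
    using assms by (intro sum.mono_neutral_cong_right) (auto simp: hook_summand_def)
  ultimately show ?thesis
    by (simp add: right_diff_distrib sum_subtractf sum_distrib_left mult_ac)
qed

lemma power_trace_newton:
  "(\<Sum>k=1..n. power_trace k g * newton 1 (n - k) g) = of_nat n * newton 1 n g"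
  "(\<Sum>k=1..n. power_trace k g * newton (-1) (n - k) g) = - of_nat n * newton (-1) n g"
  using newton_recursion[where s = 1 and n = n and g = g] newton_recursion[where s = "-1" and n = n and g = g]
  by (auto simp: minus_equation_iff)

lemma hook_summand_euler:
  "(\<Sum>k=1..n. power_trace k g * (hook_summand (n - k) c g - (if k \<le> c then hook_summand (n - k) (c - k) g else 0)))
    = of_nat n * hook_summand n c g"
proof (cases "c \<le> n")
  case True
  show ?thesis
    unfolding sum_hook_summand_gradient[OF True] power_trace_newton
    using True by (simp add: hook_summand_def of_nat_diff algebra_simps)
next
  case False
  have "hook_summand (n - k) c g - (if k \<le> c then hook_summand (n - k) (c - k) g else 0) = 0" if "k \<in> {1..n}" for k
    using False that by (auto simp: hook_summand_def)
  thus ?thesis using False by (simp add: hook_summand_def)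
qed

lemma hook_difference:
  "(\<Sum>c\<le>b. hook_summand (n - k) c g - (if k \<le> c then hook_summand (n - k) (c - k) g else 0)) =
    hook (n - k) b g - (if k \<le> b then hook (n - k) (b - k) g else 0)"
proof -
  have "(\<Sum>c\<le>b. if k \<le> c then hook_summand (n - k) (c - k) g else 0) = (\<Sum>c\<in>{k..b}. hook_summand (n - k) (c - k) g)"
    by (intro sum.mono_neutral_cong_right) auto
  also have "\<dots> = (if k \<le> b then hook (n - k) (b - k) g else 0)"
    by (auto simp: hook_def intro!: sum.reindex_bij_witness[where i = "\<lambda>c. c + k" and j = "\<lambda>c. c - k"])
  finally show ?thesis by (simp add: sum_subtractf hook_def)
qed

lemma sum_hook_gradient:
  "(\<Sum>c\<le>b. \<Sum>k=1..n. x k * (hook_summand (n - k) c g - (if k \<le> c then hook_summand (n - k) (c - k) g else 0))) =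
   (\<Sum>k=1..n. x k * (hook (n - k) b g - (if k \<le> b then hook (n - k) (b - k) g else 0)))"
  by (subst sum.swap) (simp only: sum_distrib_left[symmetric] hook_difference)

text \<open>
  The sum is the trace of the gradient, so this is Euler's identity for a polynomial of degree \<open>n\<close>.
\<close>

lemma hook_euler:
  "(\<Sum>k=1..n. power_trace k g * (hook (n - k) b g - (if k \<le> b then hook (n - k) (b - k) g else 0))) = of_nat n * hook n b g"
  unfolding sum_hook_gradient[symmetric] hook_summand_euler by (simp add: hook_def sum_distrib_left)

lemma hook_0: "hook 0 b g = 1"
proof -
  have "hook 0 b g = (\<Sum>c\<in>{0}. hook_summand 0 c g)"
    unfolding hook_def by (intro sum.mono_neutral_right) (auto simp: hook_summand_def)
  thus ?thesis by (simp add: hook_summand_def)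
qed

lemma hook_eq_top:
  assumes "n \<le> b"
  shows "hook n b g = hook n n g"
  unfolding hook_def using assms by (intro sum.mono_neutral_right) (auto simp: hook_summand_def)

text \<open>
  The relation \<open>\<Sum>\<^sub>c (-1)\<^sup>c h\<^sub>n\<^sub>-\<^sub>c e\<^sub>c = 0\<close>.  It follows from Euler's identity since the full
  sums over \<open>c\<close> do not change when the upper limit is lowered from \<open>b\<close> to \<open>b - k \<ge> n - k\<close>.
\<close>

lemma hook_eq_0:
  assumes "n \<ge> 1" "n \<le> b"
  shows "hook n b g = 0"
proof -
  have "hook (n - k) b g - (if k \<le> b then hook (n - k) (b - k) g else 0) = 0" if "k \<in> {1..n}" for k
    using that assms hook_eq_top[of "n - k" b g] hook_eq_top[of "n - k" "b - k" g] by auto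
  hence "of_nat n * hook n b g = 0"
    unfolding hook_euler[symmetric] by simp
  thus ?thesis using assms by simp
qed

lemma power_trace_hook_summand:
  "(\<Sum>k=1..n. power_trace k g * hook_summand (n - k) c g) = of_nat (n - c) * hook_summand n c g"
proof (cases "c \<le> n")
  case True
  have "(\<Sum>k=1..n. power_trace k g * hook_summand (n - k) c g) =
    (\<Sum>k=1..n - c. (power_trace k g * newton 1 (n - c - k) g) * newton (-1) c g)"
  proof (rule sum.mono_neutral_cong_right)
    show "power_trace k g * hook_summand (n - k) c g = (power_trace k g * newton 1 (n - c - k) g) * newton (-1) c g"
      if "k \<in> {1..n - c}" for k
    proof -
      have "c \<le> n - k" "n - k - c = n - c - k" using that True by auto
      thus ?thesis by (simp add: hook_summand_def)
    qed
  qed (auto simp: hook_summand_def)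
  also have "\<dots> = of_nat (n - c) * hook_summand n c g"
    unfolding sum_distrib_right[symmetric] power_trace_newton using True by (simp add: hook_summand_def)
  finally show ?thesis .
qed (auto simp: hook_summand_def intro!: sum.neutral)

text \<open>
  Newton's identity turns the weight \<open>n - c\<close> into a sum over \<open>k\<close> of \<open>p\<^sub>k\<close> times complete alternating
  sums of degree \<open>n - k\<close>, which vanish unless \<open>k = n\<close>.
\<close>

lemma power_trace_eq_weighted:
  assumes "n \<ge> 1"
  shows "power_trace n g = (\<Sum>c\<le>n. of_nat (n - c) * hook_summand n c g)"
proof -
  have "(\<Sum>c\<le>n. of_nat (n - c) * hook_summand n c g) = (\<Sum>k=1..n. power_trace k g * hook (n - k) n g)"
    unfolding power_trace_hook_summand[symmetric] hook_def sum_distrib_left by (rule sum.swap)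
  also have "\<dots> = (\<Sum>k\<in>{n}. power_trace k g * hook (n - k) n g)"
    using assms by (intro sum.mono_neutral_right) (auto simp: hook_eq_0)
  finally show ?thesis by (simp add: hook_0)
qed

text \<open>
  The Murnaghan-Nakayama expansion of \<open>p\<^sub>n\<close> into hooks; its signs are absorbed by the signs in
  \<open>hook\<close>.
\<close>

lemma power_trace_eq_sum_hook:
  assumes "n \<ge> 1"
  shows "power_trace n g = (\<Sum>b<n. hook n b g)"
proof -
  have "(\<Sum>b<m. hook n b g) = (\<Sum>c\<le>m. of_nat (m - c) * hook_summand n c g)" for m
  proof (induction m)
    case (Suc m)
    have "(\<Sum>c\<le>m. of_nat (Suc m - c) * hook_summand n c g) = (\<Sum>c\<le>m. of_nat (m - c) * hook_summand n c g + hook_summand n c g)"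
      by (intro sum.cong refl) (simp add: Suc_diff_le algebra_simps)
    with Suc show ?case by (simp add: sum.distrib hook_def)
  qed simp
  with power_trace_eq_weighted[OF assms] show ?thesis by simp
qed

section \<open>The functions H as combinations of hooks\<close>

text \<open>
  This is \<open>F\<^sub>j = E\<inverse> D\<^sup>j E\<close> coefficient by coefficient.  In the recursion the convolution with
  \<open>- p\<close> multiplies the \<open>c\<close>-th term by \<open>-(n - c)\<close> and the last summand multiplies it by \<open>n\<close>, so that
  one factor \<open>c\<close> is gained.
\<close>

lemma H_eq_weighted:
  assumes "n \<ge> 1"
  shows "H (Suc j) n g = (\<Sum>c\<le>n. of_nat c ^ Suc j * hook_summand n c g)"
  using assms
proof (induction j arbitrary: n)
  case 0
  have "(\<Sum>c\<le>n. of_nat c ^ Suc 0 * hook_summand n c g) + power_trace n g = (\<Sum>c\<le>n. of_nat n * hook_summand n c g)"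
    unfolding power_trace_eq_weighted[OF 0] sum.distrib[symmetric]
    by (intro sum.cong refl) (auto simp: of_nat_diff algebra_simps)
  also have "\<dots> = 0"
    using hook_eq_0[OF 0 order.refl, of g] by (simp add: hook_def flip: sum_distrib_left)
  finally show ?case by (simp add: power_trace_def add_eq_0_iff)
next
  case (Suc j)
  have "(\<Sum>l\<in>{1..<n}. H (Suc 0) (n - l) g * H (Suc j) l g) =
        (\<Sum>l\<in>{1..<n}. \<Sum>c\<le>n. - power_trace (n - l) g * (of_nat c ^ Suc j * hook_summand l c g))"
  proof (intro sum.cong refl)
    fix l assume l: "l \<in> {1..<n}"
    have "H (Suc j) l g = (\<Sum>c\<le>l. of_nat c ^ Suc j * hook_summand l c g)" using l by (intro Suc.IH) auto
    also have "\<dots> = (\<Sum>c\<le>n. of_nat c ^ Suc j * hook_summand l c g)"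
      using l by (intro sum.mono_neutral_left) (auto simp: hook_summand_def)
    finally show "H (Suc 0) (n - l) g * H (Suc j) l g = (\<Sum>c\<le>n. - power_trace (n - l) g * (of_nat c ^ Suc j * hook_summand l c g))"
      by (simp add: power_trace_def sum_distrib_left del: power_Suc)
  qed
  also have "\<dots> = (\<Sum>c\<le>n. \<Sum>l\<in>{1..<n}. - power_trace (n - l) g * (of_nat c ^ Suc j * hook_summand l c g))"
    by (rule sum.swap)
  also have "\<dots> = (\<Sum>c\<le>n. - (of_nat c ^ Suc j) * (of_nat (n - c) * hook_summand n c g))"
  proof (intro sum.cong refl)
    fix c
    have "(\<Sum>l\<in>{1..<n}. - power_trace (n - l) g * (of_nat c ^ Suc j * hook_summand l c g)) =
       (\<Sum>k\<in>{1..<n}. - (of_nat c ^ Suc j) * (power_trace k g * hook_summand (n - k) c g))"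
      by (rule sum.reindex_bij_witness[where i = "\<lambda>k. n - k" and j = "\<lambda>k. n - k"]) auto
    also have "\<dots> = (\<Sum>k=1..n. - (of_nat c ^ Suc j) * (power_trace k g * hook_summand (n - k) c g))"
    proof (rule sum.mono_neutral_left)
      \<comment> \<open>the missing term \<open>k = n\<close> vanishes: for \<open>c = 0\<close> because the exponent of \<open>c\<close> is positive, for \<open>c > 0\<close> because of \<open>hook_summand 0 c\<close>\<close>
      show "\<forall>k\<in>{1..n} - {1..<n}. - (of_nat c ^ Suc j) * (power_trace k g * hook_summand (n - k) c g) = 0"
        by (auto simp: hook_summand_def)
    qed auto
    finally show "(\<Sum>l\<in>{1..<n}. - power_trace (n - l) g * (of_nat c ^ Suc j * hook_summand l c g)) =
       - (of_nat c ^ Suc j) * (of_nat (n - c) * hook_summand n c g)"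
      unfolding sum_distrib_left[symmetric] power_trace_hook_summand .
  qed
  finally have "H (Suc (Suc j)) n g = (\<Sum>c\<le>n. - (of_nat c ^ Suc j) * (of_nat (n - c) * hook_summand n c g))
     + of_nat n * (\<Sum>c\<le>n. of_nat c ^ Suc j * hook_summand n c g)"
    using Suc by simp
  also have "\<dots> = (\<Sum>c\<le>n. of_nat c ^ Suc (Suc j) * hook_summand n c g)"
    unfolding sum_distrib_left sum.distrib[symmetric]
    by (intro sum.cong refl) (auto simp: of_nat_diff algebra_simps)
  finally show ?case .
qed

lemma H_eq_hooks:
  assumes "n \<ge> 1" "j \<ge> 1"
  shows "H j n g = - (\<Sum>d=1..n. (of_nat d ^ j - of_nat (d - 1) ^ j) * hook n (d - 1) g)"
proof -
  have "(\<Sum>c\<le>m. of_nat c ^ j * hook_summand n c g) =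
     of_nat m ^ j * hook n m g - (\<Sum>d=1..m. (of_nat d ^ j - of_nat (d - 1) ^ j) * hook n (d - 1) g)" for m
  proof (induction m)
    case 0
    show ?case using assms by simp
  next
    case (Suc m)
    thus ?case by (simp add: hook_def algebra_simps)
  qed
  from this[of n] show ?thesis
    using H_eq_weighted[OF assms(1), of "j - 1" g] assms hook_eq_0[OF assms(1) order.refl, of g] by simp
qed

section \<open>Hooks are eigenfunctions of the Casimir operator\<close>

text \<open>
  The product rule, with the eigenvalues of the two factors and the mixed term from
  \<open>newton_cross_sum\<close>.  The operator is triangular on these products; the partial sums over \<open>c\<close>
  diagonalise it.
\<close>

lemma has_laplacian_hook_summand:
  assumes c: "c \<le> n"
  shows "has_laplacian (hook_summand n c :: complex^'n^'n \<Rightarrow> complex)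
    (\<lambda>g. \<chi> i j. \<Sum>k=1..n. matrix_power g k $ i $ j *
        (hook_summand (n - k) c g - (if k \<le> c then hook_summand (n - k) (c - k) g else 0)))
    (\<lambda>g. of_nat n * (of_nat CARD('n) + of_nat n - 1 - 2 * of_nat c) * hook_summand n c g
       - 2 * of_nat n * (\<Sum>d<c. hook_summand n d g))"
proof (rule has_laplacian_cong[OF has_laplacian_mult[OF
      has_laplacian_newton[of 1 "n - c"] has_laplacian_newton[of "-1" c]]])
  fix g :: "complex^'n^'n"
  let ?P = "\<lambda>k i j. matrix_power g k $ i $ j"
  show "newton 1 (n - c) g * newton (-1) c g = hook_summand n c g"
    using c by (simp add: hook_summand_def)
  fix i j
  show "(\<chi> i j. newton 1 (n - c) g * (\<chi> i j. - 1 * (\<Sum>k = 1..c. ?P k i j * newton (- 1) (c - k) g)) $ i $ j +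
         newton (- 1) c g * (\<chi> i j. 1 * (\<Sum>k = 1..n - c. ?P k i j * newton 1 (n - c - k) g)) $ i $ j) $ i $ j =
       (\<chi> i j. \<Sum>k=1..n. ?P k i j *
        (hook_summand (n - k) c g - (if k \<le> c then hook_summand (n - k) (c - k) g else 0))) $ i $ j"
    using sum_hook_summand_gradient[OF c, of "\<lambda>k. ?P k i j" g] by (simp add: diff_diff_add)
next
  fix g :: "complex^'n^'n"
  let ?P = "\<lambda>k i j. matrix_power g k $ i $ j"
  let ?h = "\<lambda>n. newton 1 n g" and ?e = "\<lambda>n. newton (-1) n g"
  have "(\<Sum>i\<in>UNIV. \<Sum>j\<in>UNIV. (\<Sum>k=1..n - c. ?P k i j * ?h (n - c - k)) * (\<Sum>l=1..c. ?P l j i * ?e (c - l))) =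
    (\<Sum>k=1..n - c. \<Sum>l=1..c. power_trace (k + l) g * (?h (n - c - k) * ?e (c - l)))"
  proof -
    have "(\<Sum>i\<in>UNIV. \<Sum>j\<in>UNIV. (\<Sum>k=1..n - c. ?P k i j * ?h (n - c - k)) * (\<Sum>l=1..c. ?P l j i * ?e (c - l))) =
      (\<Sum>i\<in>UNIV. \<Sum>j\<in>UNIV. \<Sum>k=1..n - c. \<Sum>l=1..c. (?P k i j * ?P l j i) * (?h (n - c - k) * ?e (c - l)))"
      unfolding sum_product by (simp only: mult_ac)
    also have "\<dots> = (\<Sum>k=1..n - c. \<Sum>i\<in>UNIV. \<Sum>j\<in>UNIV. \<Sum>l=1..c. (?P k i j * ?P l j i) * (?h (n - c - k) * ?e (c - l)))"
      by (rule sum_swap_innermost)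
    also have "\<dots> = (\<Sum>k=1..n - c. \<Sum>l=1..c. \<Sum>i\<in>UNIV. \<Sum>j\<in>UNIV. (?P k i j * ?P l j i) * (?h (n - c - k) * ?e (c - l)))"
      by (intro sum.cong refl sum_swap_innermost)
    finally show ?thesis
      unfolding sum_distrib_right[symmetric] trace_matrix_power_mult .
  qed
  also have "\<dots> = of_nat c * (?h (n - c) * ?e c) + of_nat n * (\<Sum>d<c. ?h (n - d) * ?e d)"
    by (rule newton_cross_sum) (use c power_trace_newton in auto)
  also have "\<dots> = of_nat c * hook_summand n c g + of_nat n * (\<Sum>d<c. hook_summand n d g)"
    using c by (simp add: hook_summand_def)
  finally have cross: "(\<Sum>i\<in>UNIV. \<Sum>j\<in>UNIV. (\<Sum>k=1..n - c. ?P k i j * ?h (n - c - k)) * (\<Sum>l=1..c. ?P l j i * ?e (c - l))) = \<dots>" .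
  have prod: "?h (n - c) * ?e c = hook_summand n c g"
    using c by (simp add: hook_summand_def)
  have "newton 1 (n - c) g * (of_nat c * (of_nat CARD('n) + - 1 * (of_nat c - 1)) * newton (- 1) c g) +
        newton (- 1) c g * (of_nat (n - c) * (of_nat CARD('n) + 1 * (of_nat (n - c) - 1)) * newton 1 (n - c) g) +
        2 * (\<Sum>i\<in>UNIV. \<Sum>j\<in>UNIV. (1 * (\<Sum>k = 1..n - c. ?P k i j * newton 1 (n - c - k) g)) *
            (- 1 * (\<Sum>k = 1..c. ?P k j i * newton (- 1) (c - k) g))) =
     (of_nat c * (of_nat CARD('n) + 1 - of_nat c) + (of_nat n - of_nat c) * (of_nat CARD('n) + of_nat n - of_nat c - 1))
       * (?h (n - c) * ?e c)
     - 2 * (\<Sum>i\<in>UNIV. \<Sum>j\<in>UNIV. (\<Sum>k=1..n - c. ?P k i j * ?h (n - c - k)) * (\<Sum>l=1..c. ?P l j i * ?e (c - l)))"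
    using c by (simp add: of_nat_diff sum_negf algebra_simps)
  also have "\<dots> = of_nat n * (of_nat CARD('n) + of_nat n - 1 - 2 * of_nat c) * hook_summand n c g
       - 2 * of_nat n * (\<Sum>d<c. hook_summand n d g)"
    unfolding cross prod by (simp add: algebra_simps)
  finally show "newton 1 (n - c) g * (of_nat c * (of_nat CARD('n) + - 1 * (of_nat c - 1)) * newton (- 1) c g) +
        newton (- 1) c g * (of_nat (n - c) * (of_nat CARD('n) + 1 * (of_nat (n - c) - 1)) * newton 1 (n - c) g) +
        2 * (\<Sum>i\<in>UNIV. \<Sum>j\<in>UNIV. (\<chi> i j. 1 * (\<Sum>k = 1..n - c. ?P k i j * newton 1 (n - c - k) g)) $ i $ j *
            (\<chi> i j. - 1 * (\<Sum>k = 1..c. ?P k i j * newton (- 1) (c - k) g)) $ j $ i) =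
     of_nat n * (of_nat CARD('n) + of_nat n - 1 - 2 * of_nat c) * hook_summand n c g
       - 2 * of_nat n * (\<Sum>d<c. hook_summand n d g)"
    by (simp only: vec_lambda_beta)
qed auto

text \<open>
  Passing from \<open>b\<close> to \<open>b + 1\<close> lowers the eigenvalue by \<open>2 n\<close>, and this is exactly the off-diagonal
  contribution of the new summand.
\<close>

lemma has_laplacian_hook:
  assumes b: "b \<le> n"
  shows "has_laplacian (hook n b :: complex^'n^'n \<Rightarrow> complex)
    (\<lambda>g. \<chi> i j. \<Sum>k=1..n. matrix_power g k $ i $ j * (hook (n - k) b g - (if k \<le> b then hook (n - k) (b - k) g else 0)))
    (\<lambda>g. of_nat n * (of_nat CARD('n) + of_nat n - 1 - 2 * of_nat b) * hook n b g)"
proof (rule has_laplacian_cong[OF has_laplacian_sum[of "{..b}", OF has_laplacian_hook_summand]])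
  show "c \<le> n" if "c \<in> {..b}" for c using b that by simp
  fix g :: "complex^'n^'n"
  show "(\<Sum>c\<le>b. hook_summand n c g) = hook n b g" by (simp add: hook_def)
  show "(\<Sum>c\<le>b. \<chi> i j. \<Sum>k=1..n. matrix_power g k $ i $ j *
        (hook_summand (n - k) c g - (if k \<le> c then hook_summand (n - k) (c - k) g else 0))) $ i $ j =
     (\<chi> i j. \<Sum>k=1..n. matrix_power g k $ i $ j * (hook (n - k) b g - (if k \<le> b then hook (n - k) (b - k) g else 0))) $ i $ j" for i j
    unfolding sum_component vec_lambda_beta by (rule sum_hook_gradient)
  let ?N = "of_nat CARD('n) :: complex"
  show "(\<Sum>c\<le>b. of_nat n * (?N + of_nat n - 1 - 2 * of_nat c) * hook_summand n c g
       - 2 * of_nat n * (\<Sum>d<c. hook_summand n d g)) =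
       of_nat n * (?N + of_nat n - 1 - 2 * of_nat b) * hook n b g"
  proof (induction b)
    case 0
    show ?case by (simp add: hook_def)
  next
    case (Suc b)
    thus ?case by (simp add: hook_def lessThan_Suc_atMost algebra_simps)
  qed
qed

section \<open>Orthonormality of hooks\<close>

lemma continuous_on_newton [continuous_intros]: "continuous_on S (newton s n)"
  by (rule has_gradient_continuous(1)[OF has_gradient_newton])

lemma continuous_on_power_trace [continuous_intros]: "continuous_on S (power_trace n)"
  by (rule has_gradient_continuous(1)[OF has_gradient_power_trace])

lemma continuous_on_hook [continuous_intros]: "continuous_on S (hook n b)"
proof -
  have "continuous_on S (hook_summand n c)" for c
    by (cases "c \<le> n") (auto simp: hook_summand_def[abs_def] intro!: continuous_intros)
  thus ?thesis unfolding hook_def[abs_def] by (intro continuous_on_sum)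
qed

definition haar_inner :: "(complex^'n^'n) measure \<Rightarrow> (complex^'n^'n \<Rightarrow> complex) \<Rightarrow> (complex^'n^'n \<Rightarrow> complex) \<Rightarrow> complex" where
  "haar_inner M f \<phi> = (LINT g|M. f g * cnj (\<phi> g))"

lemma haar_inner_commute: "haar_inner M \<phi> f = cnj (haar_inner M f \<phi>)"
  using Bochner_Integration.integral_cnj[of M "\<lambda>g. f g * cnj (\<phi> g)"] by (simp add: haar_inner_def mult.commute)

lemma matrix_power_unitary: "g \<in> unitary_group \<Longrightarrow> matrix_power g k \<in> unitary_group"
proof (induction k)
  case 0
  have "conj_transpose (mat 1 :: complex^'n^'n) = mat 1"
    by (auto simp: conj_transpose_def mat_def vec_eq_iff)
  thus ?case by (simp add: unitary_group_def)
qed (simp add: unitary_mult)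

text \<open>
  For unitary \<open>g\<close> the entrywise inner product of \<open>g\<^sup>k\<close> and \<open>g\<^sup>n\<close> is \<open>Tr (g\<^sup>k g\<^sup>-\<^sup>n)\<close>.
\<close>

lemma matrix_power_frobenius_inner:
  assumes g: "g \<in> unitary_group" and "k \<le> n"
  shows "(\<Sum>i\<in>UNIV. \<Sum>j\<in>UNIV. matrix_power g k $ i $ j * cnj (matrix_power g n $ i $ j)) = cnj (power_trace (n - k) g)"
proof -
  have "matrix_power g n ** conj_transpose (matrix_power g k) =
        matrix_power g (n - k) ** (matrix_power g k ** conj_transpose (matrix_power g k))"
    using assms matrix_power_add[of g "n - k" k] by (simp add: matrix_mul_assoc)
  also have "\<dots> = matrix_power g (n - k)"
    using matrix_power_unitary[OF g, of k] by (simp add: unitary_group_def)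
  finally have "cnj (power_trace (n - k) g) = cnj (trace (matrix_power g n ** conj_transpose (matrix_power g k)))"
    by (simp add: power_trace_def)
  thus ?thesis
    by (simp add: trace_def matrix_matrix_mult_def conj_transpose_def mult.commute)
qed

text \<open>
  The eigenvalue \<open>c (N + 1 - c)\<close> is not positive, so the Green identity of the function with itself
  leaves only the possibility that the gradient is 0 almost everywhere; its trace is \<open>c\<close> times the
  function.
\<close>

lemma newton_minus_one_eq_0_AE:
  fixes M :: "(complex^'n^'n) measure"
  assumes M: "haar_prob_measure M" and c: "c > CARD('n)"
  shows "AE g in M. newton (-1) c g = 0"
proof -
  let ?W = "\<lambda>g :: complex^'n^'n. \<chi> i j. - 1 * (\<Sum>k=1..c. matrix_power g k $ i $ j * newton (-1) (c - k) g)"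
  note lap = has_laplacian_newton[of "-1" c, where 'n = 'n]
  have grad: "has_gradient (newton (-1) c) ?W" by (rule has_gradient_newton)
  have contW: "continuous_on S (\<lambda>g. ?W g $ i $ j)" for S i j
    by (intro continuous_intros has_gradient_continuous(2)[OF grad])
  have sq: "(LINT g|M. f g * cnj (f g)) = of_real (LINT g|M. (cmod (f g))\<^sup>2)" for f
    unfolding complex_norm_square[symmetric] by (rule integral_complex_of_real)
  \<comment> \<open>the eigenvalue, which is real and not positive\<close>
  define r :: real where "r = of_nat c * (of_nat CARD('n) + 1 - of_nat c)"
  have "of_real (r * (LINT g|M. (cmod (newton (-1) c g))\<^sup>2)) =
        complex_of_real r * (LINT g|M. newton (-1) c g * cnj (newton (-1) c g))"
    unfolding sq by simp
  also have "\<dots> = (LINT g|M. (of_nat c * (of_nat CARD('n) + - 1 * (of_nat c - 1)) * newton (-1) c g) * cnj (newton (-1) c g))"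
    unfolding integral_mult_right_zero[symmetric] by (simp add: r_def algebra_simps)
  also have "\<dots> = (\<Sum>i\<in>UNIV. \<Sum>j\<in>UNIV. LINT g|M. ?W g $ i $ j * cnj (?W g $ i $ j))"
    by (rule green_identity[OF M lap grad]) simp
  also have "\<dots> = of_real (\<Sum>i\<in>UNIV. \<Sum>j\<in>UNIV. LINT g|M. (cmod (?W g $ i $ j))\<^sup>2)"
    unfolding sq by simp
  finally have eq: "(\<Sum>i\<in>UNIV. \<Sum>j\<in>UNIV. LINT g|M. (cmod (?W g $ i $ j))\<^sup>2) = r * (LINT g|M. (cmod (newton (-1) c g))\<^sup>2)"
    unfolding of_real_eq_iff by simp
  have "r \<le> 0" using c by (simp add: r_def mult_le_0_iff)
  hence "(\<Sum>i\<in>UNIV. \<Sum>j\<in>UNIV. LINT g|M. (cmod (?W g $ i $ j))\<^sup>2) \<le> 0"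
    unfolding eq by (intro mult_nonpos_nonneg integral_nonneg_AE) auto
  hence "(\<Sum>i\<in>UNIV. \<Sum>j\<in>UNIV. LINT g|M. (cmod (?W g $ i $ j))\<^sup>2) = 0"
    by (intro antisym sum_nonneg integral_nonneg_AE) auto
  hence zero: "(LINT g|M. (cmod (?W g $ i $ j))\<^sup>2) = 0" for i j
    by (simp add: sum_nonneg_eq_0_iff sum_nonneg integral_nonneg_AE)
  have "AE g in M. ?W g $ i $ j = 0" for i j
  proof -
    have "integrable M (\<lambda>g. complex_of_real ((cmod (?W g $ i $ j))\<^sup>2))"
      by (intro haar_integrable[OF M] continuous_intros contW)
    hence "integrable M (\<lambda>g. (cmod (?W g $ i $ j))\<^sup>2)"
      by (rule complex_of_real_integrable_eq[THEN iffD1])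
    from integral_nonneg_eq_0_iff_AE[OF this] zero[of i j] show ?thesis by simp
  qed
  hence "AE g in M. \<forall>i. ?W g $ i $ i = 0"
    unfolding AE_all_countable by (intro allI)
  thus ?thesis
  proof (rule AE_mp, intro AE_I2 impI)
    fix g :: "complex^'n^'n" assume "\<forall>i. ?W g $ i $ i = 0"
    hence "0 = (\<Sum>i\<in>UNIV. ?W g $ i $ i)" by simp
    also have "\<dots> = - 1 * (\<Sum>k=1..c. power_trace k g * newton (-1) (c - k) g)"
      unfolding vec_lambda_beta sum_distrib_left[symmetric]
      by (subst sum.swap) (simp add: power_trace_def trace_def sum_distrib_right)
    also have "\<dots> = of_nat c * newton (-1) c g" by (rule newton_recursion)
    finally show "newton (-1) c g = 0" using c by simp
  qed
qed

text \<open>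
  The summands beyond \<open>b\<close> contain some \<open>e\<^sub>c\<close> with \<open>c > N\<close>, so almost everywhere the partial sum
  agrees with the full alternating sum, which is 0.
\<close>

lemma hook_eq_0_AE:
  fixes M :: "(complex^'n^'n) measure"
  assumes M: "haar_prob_measure M" and n: "n \<ge> 1" and b: "b \<ge> CARD('n)"
  shows "AE g in M. hook n b g = 0"
proof (cases "n \<le> b")
  case True
  thus ?thesis using n by (simp add: hook_eq_0)
next
  case False
  have "AE g in M. \<forall>c. c > CARD('n) \<longrightarrow> newton (-1) c g = 0"
    unfolding AE_all_countable
  proof
    show "AE g in M. c > CARD('n) \<longrightarrow> newton (-1) c g = 0" for c
      by (cases "c > CARD('n)") (use newton_minus_one_eq_0_AE[OF M, of c] in auto)
  qed
  thus ?thesis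
  proof (rule AE_mp, intro AE_I2 impI)
    fix g :: "complex^'n^'n" assume g: "\<forall>c. c > CARD('n) \<longrightarrow> newton (-1) c g = 0"
    have "hook n b g = hook n n g"
      unfolding hook_def using False b g by (intro sum.mono_neutral_left) (auto simp: hook_summand_def)
    thus "hook n b g = 0" using hook_eq_0[OF n order.refl, of g] by simp
  qed
qed

text \<open>
  By the Green identity the Casimir operator is self-adjoint, and the eigenvalues of the two hooks
  differ by \<open>2 n (b - d)\<close>.
\<close>

lemma hook_orthogonal:
  fixes M :: "(complex^'n^'n) measure"
  assumes M: "haar_prob_measure M" and n: "n \<ge> 1" and bd: "b \<le> n" "d \<le> n" "b \<noteq> d"
  shows "haar_inner M (hook n b) (hook n d) = 0"
proof -
  define ev :: "nat \<Rightarrow> complex" where "ev b = of_nat n * (of_nat CARD('n) + of_nat n - 1 - 2 * of_nat b)" for b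
  define W where "W b g = (\<chi> i j. \<Sum>k=1..n. matrix_power g k $ i $ j *
      (hook (n - k) b g - (if k \<le> b then hook (n - k) (b - k) g else 0)))" for b and g :: "complex^'n^'n"
  have lap: "has_laplacian (hook n b) (W b) (\<lambda>g. ev b * hook n b g)" if "b \<le> n" for b
    unfolding W_def[abs_def] ev_def by (rule has_laplacian_hook[OF that])
  have green: "ev b * haar_inner M (hook n b) (hook n d) =
      (\<Sum>i\<in>UNIV. \<Sum>j\<in>UNIV. haar_inner M (\<lambda>g. W b g $ i $ j) (\<lambda>g. W d g $ i $ j))" if "b \<le> n" "d \<le> n" for b d
    using green_identity[OF M lap[OF that(1)], of "hook n d" "W d"] lap[OF that(2)]
    by (simp add: has_laplacian_def haar_inner_def mult.assoc)
  \<comment> \<open>the eigenvalues are real, so conjugation moves the operator to the other factor\<close>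
  have "ev d * haar_inner M (hook n b) (hook n d) = cnj (ev d * haar_inner M (hook n d) (hook n b))"
    by (simp add: ev_def haar_inner_commute[of M "hook n d"])
  also have "\<dots> = (\<Sum>i\<in>UNIV. \<Sum>j\<in>UNIV. haar_inner M (\<lambda>g. W b g $ i $ j) (\<lambda>g. W d g $ i $ j))"
    unfolding green[OF bd(2,1)] cnj_sum by (simp add: haar_inner_commute[symmetric])
  also have "\<dots> = ev b * haar_inner M (hook n b) (hook n d)"
    by (rule green[OF bd(1,2), symmetric])
  finally have "of_nat n * (of_nat b - of_nat d) * haar_inner M (hook n b) (hook n d) = 0"
    by (simp add: ev_def algebra_simps)
  thus ?thesis using n bd(3) by simp
qed

text \<open>
  Integration by parts on the diagonal shows that the degree operator, the trace of the gradient, is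
  self-adjoint.
\<close>

lemma hook_orthogonal_degree:
  fixes M :: "(complex^'n^'n) measure"
  assumes M: "haar_prob_measure M" and nm: "n \<noteq> m" and bd: "b \<le> n" "d \<le> m"
  shows "haar_inner M (hook n b) (hook m d) = 0"
proof -
  define W where "W n b g = (\<chi> i j. \<Sum>k=1..n. matrix_power g k $ i $ j *
      (hook (n - k) b g - (if k \<le> b then hook (n - k) (b - k) g else 0)))" for n b and g :: "complex^'n^'n"
  have grad: "has_gradient (hook n b) (W n b)" if "b \<le> n" for n b
    using has_laplacian_hook[OF that] unfolding W_def[abs_def] has_laplacian_def by blast
  have tr: "(\<Sum>i\<in>UNIV. W n b g $ i $ i) = of_nat n * hook n b g" for n b g
    unfolding hook_euler[symmetric] W_def vec_lambda_beta
    by (subst sum.swap) (simp add: power_trace_def trace_def sum_distrib_right)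
  note cont = has_gradient_continuous(2)[OF grad[OF bd(1)]] has_gradient_continuous(2)[OF grad[OF bd(2)]]
  note int = haar_integrable[OF M] continuous_intros cont
  have "of_nat n * haar_inner M (hook n b) (hook m d) = (LINT g|M. (\<Sum>i\<in>UNIV. W n b g $ i $ i * cnj (hook m d g)))"
    unfolding haar_inner_def integral_mult_right_zero[symmetric] sum_distrib_right[symmetric] tr by (simp add: mult.assoc)
  also have "\<dots> = (\<Sum>i\<in>UNIV. LINT g|M. W n b g $ i $ i * cnj (hook m d g))"
    by (intro Bochner_Integration.integral_sum int)
  also have "\<dots> = (\<Sum>i\<in>UNIV. LINT g|M. hook n b g * cnj (W m d g $ i $ i))"
    by (intro sum.cong refl integration_by_parts[OF M grad[OF bd(1)] grad[OF bd(2)]])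
  also have "\<dots> = (LINT g|M. (\<Sum>i\<in>UNIV. hook n b g * cnj (W m d g $ i $ i)))"
    by (intro Bochner_Integration.integral_sum[symmetric] int)
  also have "\<dots> = of_nat m * haar_inner M (hook n b) (hook m d)"
    unfolding haar_inner_def integral_mult_right_zero[symmetric] sum_distrib_left[symmetric] cnj_sum[symmetric] tr
    by (simp add: mult_ac)
  finally show ?thesis using nm by simp
qed

lemma haar_inner_hook_power_trace:
  fixes M :: "(complex^'n^'n) measure"
  assumes M: "haar_prob_measure M" and m: "m \<ge> 1"
  shows "haar_inner M (hook m b) (power_trace m) = (if b < m then haar_inner M (hook m b) (hook m b) else 0)"
proof (cases "b < m")
  case True
  have "haar_inner M (hook m b) (power_trace m) = (LINT g|M. (\<Sum>d<m. hook m b g * cnj (hook m d g)))"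
    unfolding haar_inner_def power_trace_eq_sum_hook[OF m] by (simp add: sum_distrib_left)
  also have "\<dots> = (\<Sum>d<m. haar_inner M (hook m b) (hook m d))"
    unfolding haar_inner_def
    by (intro Bochner_Integration.integral_sum haar_integrable[OF M] continuous_intros)
  also have "\<dots> = (\<Sum>d\<in>{b}. haar_inner M (hook m b) (hook m d))"
    using True by (intro sum.mono_neutral_right) (auto intro!: hook_orthogonal[OF M m])
  finally show ?thesis using True by simp
next
  case False
  thus ?thesis using m by (simp add: haar_inner_def hook_eq_0)
qed

text \<open>
  The Green identity for the hook and \<open>p\<^sub>n\<close>.  On the left, \<open>p\<^sub>n\<close> may be replaced by its only component
  along the hook; on the right, \<open>\<nabla>p\<^sub>n = n g\<^sup>n\<close> meets the term \<open>g\<^sup>k\<close> of the other gradient in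
  \<open>cnj p\<^sub>n\<^sub>-\<^sub>k\<close>.  The term \<open>k = n\<close> contributes \<open>N\<close>.
\<close>

lemma hook_norm_recursion:
  fixes M :: "(complex^'n^'n) measure"
  assumes M: "haar_prob_measure M" and n: "n \<ge> 1" and b: "b < n"
  shows "(of_nat CARD('n) + of_nat n - 1 - 2 * of_nat b) * haar_inner M (hook n b) (hook n b) =
    (\<Sum>k=1..<n. haar_inner M (hook (n - k) b) (power_trace (n - k))
        - (if k \<le> b then haar_inner M (hook (n - k) (b - k)) (power_trace (n - k)) else 0))
    + of_nat CARD('n)"
proof -
  interpret prob_space M using M by (simp add: haar_prob_measure_def)
  define A where "A k g = hook (n - k) b g - (if k \<le> b then hook (n - k) (b - k) g else 0)" for k and g :: "complex^'n^'n"
  have contA: "continuous_on S (A k)" for S k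
    unfolding A_def[abs_def] by (cases "k \<le> b") (auto intro!: continuous_intros)
  have contP: "continuous_on S (\<lambda>g :: complex^'n^'n. matrix_power g k $ i $ j)" for S k i j
    by (rule has_gradient_continuous(1)[OF has_gradient_matrix_power_entry])
  let ?ev = "of_nat n * (of_nat CARD('n) + of_nat n - 1 - 2 * of_nat b) :: complex"
  have "?ev * haar_inner M (hook n b) (power_trace n) =
    (\<Sum>i\<in>UNIV. \<Sum>j\<in>UNIV. LINT g|M. (\<Sum>k=1..n. matrix_power g k $ i $ j * A k g) * cnj (of_nat n * matrix_power g n $ i $ j))"
    using green_identity[OF M has_laplacian_hook has_gradient_power_trace[of n], of b n] b
    unfolding A_def haar_inner_def by (simp add: mult.assoc)
  also have "\<dots> = (LINT g|M. (\<Sum>i\<in>UNIV. \<Sum>j\<in>UNIV. (\<Sum>k=1..n. matrix_power g k $ i $ j * A k g) * cnj (of_nat n * matrix_power g n $ i $ j)))"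
    by (subst Bochner_Integration.integral_sum, intro haar_integrable[OF M] continuous_intros contA contP,
        subst Bochner_Integration.integral_sum, intro haar_integrable[OF M] continuous_intros contA contP, rule refl)
  also have "\<dots> = (LINT g|M. of_nat n * (\<Sum>k=1..n. A k g * cnj (power_trace (n - k) g)))"
  proof (rule Bochner_Integration.integral_cong[OF refl])
    fix g assume "g \<in> space M"
    hence g: "g \<in> unitary_group" using M by (simp add: haar_prob_measure_def)
    have "(\<Sum>i\<in>UNIV. \<Sum>j\<in>UNIV. (\<Sum>k=1..n. matrix_power g k $ i $ j * A k g) * cnj (of_nat n * matrix_power g n $ i $ j)) =
      (\<Sum>i\<in>UNIV. \<Sum>j\<in>UNIV. \<Sum>k=1..n. of_nat n * (A k g * (matrix_power g k $ i $ j * cnj (matrix_power g n $ i $ j))))"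
      by (simp add: sum_distrib_left sum_distrib_right mult_ac)
    also have "\<dots> = (\<Sum>k=1..n. \<Sum>i\<in>UNIV. \<Sum>j\<in>UNIV. of_nat n * (A k g * (matrix_power g k $ i $ j * cnj (matrix_power g n $ i $ j))))"
      by (rule sum_swap_innermost)
    also have "\<dots> = of_nat n * (\<Sum>k=1..n. A k g * cnj (power_trace (n - k) g))"
      unfolding sum_distrib_left[symmetric] by (simp add: matrix_power_frobenius_inner[OF g])
    finally show "(\<Sum>i\<in>UNIV. \<Sum>j\<in>UNIV. (\<Sum>k=1..n. matrix_power g k $ i $ j * A k g) * cnj (of_nat n * matrix_power g n $ i $ j)) =
      of_nat n * (\<Sum>k=1..n. A k g * cnj (power_trace (n - k) g))" .
  qed
  also have "\<dots> = of_nat n * (\<Sum>k=1..n. LINT g|M. A k g * cnj (power_trace (n - k) g))"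
    unfolding integral_mult_right_zero
    by (subst Bochner_Integration.integral_sum, intro haar_integrable[OF M] continuous_intros contA, rule refl)
  finally have "(of_nat CARD('n) + of_nat n - 1 - 2 * of_nat b) * haar_inner M (hook n b) (hook n b) =
    (\<Sum>k=1..n. LINT g|M. A k g * cnj (power_trace (n - k) g))"
    using n b by (simp add: haar_inner_hook_power_trace[OF M n] mult.assoc)
  also have "{1..n} = insert n {1..<n}" using n by auto
  also have "(\<Sum>k\<in>insert n {1..<n}. LINT g|M. A k g * cnj (power_trace (n - k) g)) =
     (\<Sum>k=1..<n. LINT g|M. A k g * cnj (power_trace (n - k) g)) + (LINT g|M. A n g * cnj (power_trace 0 g))"
    by (simp add: add.commute)
  also have "(LINT g|M. A n g * cnj (power_trace 0 g)) = of_nat CARD('n)"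
    using b prob_space by (simp add: A_def hook_0 power_trace_0)
  also have "(\<Sum>k=1..<n. LINT g|M. A k g * cnj (power_trace (n - k) g)) =
    (\<Sum>k=1..<n. haar_inner M (hook (n - k) b) (power_trace (n - k))
        - (if k \<le> b then haar_inner M (hook (n - k) (b - k)) (power_trace (n - k)) else 0))"
  proof (intro sum.cong refl)
    fix k
    have "(LINT g|M. hook (n - k) b g * cnj (power_trace (n - k) g) - hook (n - k) (b - k) g * cnj (power_trace (n - k) g)) =
      haar_inner M (hook (n - k) b) (power_trace (n - k)) - haar_inner M (hook (n - k) (b - k)) (power_trace (n - k))"
      unfolding haar_inner_def
      by (intro Bochner_Integration.integral_diff haar_integrable[OF M] continuous_intros)
    thus "(LINT g|M. A k g * cnj (power_trace (n - k) g)) = haar_inner M (hook (n - k) b) (power_trace (n - k))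
        - (if k \<le> b then haar_inner M (hook (n - k) (b - k)) (power_trace (n - k)) else 0)"
      by (cases "k \<le> b") (simp_all add: A_def haar_inner_def left_diff_distrib)
  qed
  finally show ?thesis .
qed

text \<open>
  With all smaller norms equal to 1, the recursion counts \<open>n - b - 1\<close> ways to shorten the first row,
  minus \<open>b\<close> ways to shorten the first column, plus \<open>N\<close>.  This is the factor on the left, which is
  positive because \<open>b < n\<close> and \<open>b < N\<close>.
\<close>

lemma hook_norm:
  fixes M :: "(complex^'n^'n) measure"
  assumes M: "haar_prob_measure M" and "b < n" "b < CARD('n)"
  shows "haar_inner M (hook n b) (hook n b) = 1"
  using assms(2-)
proof (induction n arbitrary: b rule: less_induct)
  case (less n)
  have ip: "haar_inner M (hook (n - k) d) (power_trace (n - k)) = of_bool (d < n - k)" if "k \<in> {1..<n}" "d \<le> b" for k d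
  proof -
    have "n - k \<ge> 1" using that by auto
    thus ?thesis
      using that less.prems less.IH[of "n - k" d] by (simp add: haar_inner_hook_power_trace[OF M])
  qed
  have "(\<Sum>k=1..<n. haar_inner M (hook (n - k) b) (power_trace (n - k))
        - (if k \<le> b then haar_inner M (hook (n - k) (b - k)) (power_trace (n - k)) else 0)) =
     (\<Sum>k=1..<n. of_bool (b < n - k) - of_bool (k \<le> b))"
    using less.prems by (intro sum.cong refl) (auto simp: ip less_diff_conv)
  also have "\<dots> = of_nat (card {k \<in> {1..<n}. b < n - k}) - of_nat (card {k \<in> {1..<n}. k \<le> b})"
    by (simp add: sum_subtractf Int_def)
  also have "{k \<in> {1..<n}. b < n - k} = {1..<n - b}" by auto
  also have "{k \<in> {1..<n}. k \<le> b} = {1..b}" using less.prems by auto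
  finally have "(of_nat CARD('n) + of_nat n - 1 - 2 * of_nat b) * haar_inner M (hook n b) (hook n b) =
      of_nat (n - b - 1) - of_nat b + of_nat CARD('n)"
    using hook_norm_recursion[OF M, of n b] less.prems by simp
  also have "\<dots> = of_nat CARD('n) + of_nat n - 1 - 2 * of_nat b"
    using less.prems by (simp add: of_nat_diff algebra_simps)
  finally have eq: "(of_nat CARD('n) + of_nat n - 1 - 2 * of_nat b) * haar_inner M (hook n b) (hook n b) =
    of_nat CARD('n) + of_nat n - 1 - 2 * of_nat b" .
  have "of_nat CARD('n) + of_nat n - 1 - 2 * of_nat b = complex_of_nat (CARD('n) + n - 1 - 2 * b)"
    using less.prems by (simp add: of_nat_diff)
  moreover have "CARD('n) + n - 1 - 2 * b \<noteq> 0" using less.prems by simp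
  ultimately have "of_nat CARD('n) + of_nat n - 1 - 2 * of_nat b \<noteq> (0 :: complex)"
    by (simp only: of_nat_eq_0_iff not_False_eq_True)
  with eq show ?case by simp
qed

theorem hook_orthonormal:
  fixes M :: "(complex^'n^'n) measure"
  assumes M: "haar_prob_measure M" and b: "b < n" and d: "d < m"
  shows "haar_inner M (hook n b) (hook m d) = of_bool (n = m \<and> b = d \<and> b < CARD('n))"
proof (cases "n = m \<and> b = d")
  case True
  have "haar_inner M (hook n b) (hook n b) = 0" if "b \<ge> CARD('n)"
  proof -
    have "AE g in M. hook n b g * cnj (hook n b g) = 0"
      using hook_eq_0_AE[OF M _ that, of n] b by auto
    thus ?thesis unfolding haar_inner_def by (rule integral_eq_zero_AE)
  qed
  with True hook_norm[OF M b] show ?thesis by (cases "b < CARD('n)") auto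
next
  case False
  with hook_orthogonal[OF M, of n b d] hook_orthogonal_degree[OF M, of n m b d] b d show ?thesis
    by (cases "n = m") auto
qed

section \<open>The integrals\<close>

lemma haar_inner_H:
  fixes M :: "(complex^'n^'n) measure"
  assumes M: "haar_prob_measure M" and "j \<ge> 1" "k \<ge> 1" "n \<ge> 1" "m \<ge> 1"
  shows "(LINT g|M. H j n g * cnj (H k m g)) =
    (\<Sum>d=1..n. \<Sum>e=1..m. (of_nat d ^ j - of_nat (d - 1) ^ j) * (of_nat e ^ k - of_nat (e - 1) ^ k) *
       of_bool (n = m \<and> d = e \<and> d \<le> CARD('n)))"
proof -
  define \<alpha> :: "nat \<Rightarrow> nat \<Rightarrow> complex" where "\<alpha> j d = of_nat d ^ j - of_nat (d - 1) ^ j" for j d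
  have cnj_\<alpha>: "cnj (\<alpha> j d) = \<alpha> j d" for j d by (simp add: \<alpha>_def)
  have "(LINT g|M. H j n g * cnj (H k m g)) =
    (LINT g|M. (\<Sum>d=1..n. \<Sum>e=1..m. \<alpha> j d * \<alpha> k e * (hook n (d - 1) g * cnj (hook m (e - 1) g))))"
    unfolding H_eq_hooks[OF assms(4,2)] H_eq_hooks[OF assms(5,3)] \<alpha>_def[symmetric]
    by (simp add: sum_product cnj_\<alpha> mult_ac)
  also have "\<dots> = (\<Sum>d=1..n. \<Sum>e=1..m. \<alpha> j d * \<alpha> k e * haar_inner M (hook n (d - 1)) (hook m (e - 1)))"
    unfolding haar_inner_def integral_mult_right_zero[symmetric]
    by (subst Bochner_Integration.integral_sum, intro haar_integrable[OF M] continuous_intros,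
        subst Bochner_Integration.integral_sum, intro haar_integrable[OF M] continuous_intros, rule refl)
  also have "\<dots> = (\<Sum>d=1..n. \<Sum>e=1..m. \<alpha> j d * \<alpha> k e * of_bool (n = m \<and> d = e \<and> d \<le> CARD('n)))"
  proof (intro sum.cong refl)
    fix d e assume "d \<in> {1..n}" "e \<in> {1..m}"
    thus "\<alpha> j d * \<alpha> k e * haar_inner M (hook n (d - 1)) (hook m (e - 1)) =
      \<alpha> j d * \<alpha> k e * of_bool (n = m \<and> d = e \<and> d \<le> CARD('n))"
      by (subst hook_orthonormal[OF M]) (auto simp: of_bool_def)
  qed
  finally show ?thesis by (simp only: \<alpha>_def)
qed

theorem lemma2p2:
  fixes M :: "(complex^'n^'n) measure" and j k n :: nat
  assumes "haar_prob_measure M" and "j \<ge> 1" and "k \<ge> 1" and "n \<ge> 1"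
  shows "(LINT g|M. H j n g * cnj (H k n g)) =
           (\<Sum>d = 1..min n CARD('n).
              (of_nat d ^ j - of_nat (d - 1) ^ j) * (of_nat d ^ k - of_nat (d - 1) ^ k))
         \<and> (\<forall>m::nat. m \<ge> 1 \<and> m \<noteq> n \<longrightarrow>
              (LINT g|M. H j n g * cnj (H k m g)) = 0)"
proof (intro conjI allI impI)
  have "(LINT g|M. H j n g * cnj (H k n g)) =
    (\<Sum>d=1..n. \<Sum>e\<in>{d}. (of_nat d ^ j - of_nat (d - 1) ^ j) * (of_nat e ^ k - of_nat (e - 1) ^ k) *
       of_bool (d \<le> CARD('n)))"
    unfolding haar_inner_H[OF assms(1-3) assms(4) assms(4)]
    by (intro sum.cong refl sum.mono_neutral_cong_right) auto
  also have "\<dots> = (\<Sum>d = 1..min n CARD('n).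
              (of_nat d ^ j - of_nat (d - 1) ^ j) * (of_nat d ^ k - of_nat (d - 1) ^ k))"
    by (intro sum.mono_neutral_cong_right) auto
  finally show "(LINT g|M. H j n g * cnj (H k n g)) = \<dots>" .
next
  fix m :: nat assume "m \<ge> 1 \<and> m \<noteq> n"
  thus "(LINT g|M. H j n g * cnj (H k m g)) = 0"
    by (subst haar_inner_H[OF assms]) auto
qed

end
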